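(* (1) Let $S$ be a cancellative semigroup and let $F$ be a field. The semigroup algebra $FS$ is centrally essential if and only if the group of fractions $G_S$ of $S$ exists and the group algebra $FG_S$ is centrally essential. (2) There exist a field $F$ of characteristic zero and a semigroup $S$ (not required to be cancellative) such that the semigroup algebra $FS$ is centrally essential and non-commutative.
   Context: A semigroup is a non-empty set with an associative operation (no identity element is required). Rings are associative and not necessarily unital. A ring $R$ with center $Z(R)$ is called centrally essential if either $R$ is commutative, or for every non-central element $a\in R$ there exist non-zero central elements $x,y\in Z(R)$ with $ax=y$. For a field $F$ and a semigroup $S$, $FS$ denotes the semigroup algebra: the $F$-vector space with basis $S$ and multiplication extending that of $S$ bilinearly. A semigroup $S$ is cancellative if for all $a,b,c\in S$, $ca=cb$ implies $a=b$, and $ac=bc$ implies $a=b$. A cancellative semigroup $S$ satisfies the right (resp. left) Ore condition if $sS\cap tS\neq\emptyset$ (resp. $Ss\cap St\neq\emptyset$) for all $s,t\in S$. The group of fractions $G_S$ of $S$ is said to exist if $S$ satisfies both the right and the left Ore conditions; then $G_S$ is the group containing $S$ such that $G_S=SS^{-1}=S^{-1}S$, i.e. every element of $G_S$ can be written both as $a^{-1}b$ and as $cd^{-1}$ with $a,b,c,d\in S$. *)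

theory Defs
  imports Complex_Main "HOL-Algebra.Ring" "HOL-Algebra.Coset"
begin

text \<open>
  Semigroups and not necessarily unital rings are represented by the records of HOL-Algebra.
  Neither need have an identity: the field \<open>one\<close> of a semigroup record is unconstrained, and it
  is not used by the notions below (it is used only when the record is a group).
\<close>

locale mult_semigroup =
  fixes S (structure)
  assumes nonempty: "carrier S \<noteq> {}"
    and m_closed: "\<lbrakk>a \<in> carrier S; b \<in> carrier S\<rbrakk> \<Longrightarrow> a \<otimes> b \<in> carrier S"
    and m_assoc: "\<lbrakk>a \<in> carrier S; b \<in> carrier S; c \<in> carrier S\<rbrakk>
                    \<Longrightarrow> (a \<otimes> b) \<otimes> c = a \<otimes> (b \<otimes> c)"

locale cancellative_semigroup = mult_semigroup +
  assumes l_cancel: "\<lbrakk>a \<in> carrier S; b \<in> carrier S; c \<in> carrier S; c \<otimes> a = c \<otimes> b\<rbrakk> \<Longrightarrow> a = b"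
    and r_cancel: "\<lbrakk>a \<in> carrier S; b \<in> carrier S; c \<in> carrier S; a \<otimes> c = b \<otimes> c\<rbrakk> \<Longrightarrow> a = b"

definition right_ore :: "('s, 'm) monoid_scheme \<Rightarrow> bool" where
  "right_ore S \<longleftrightarrow> (\<forall>s \<in> carrier S. \<forall>t \<in> carrier S.
     (s <#\<^bsub>S\<^esub> carrier S) \<inter> (t <#\<^bsub>S\<^esub> carrier S) \<noteq> {})"

definition left_ore :: "('s, 'm) monoid_scheme \<Rightarrow> bool" where
  "left_ore S \<longleftrightarrow> (\<forall>s \<in> carrier S. \<forall>t \<in> carrier S.
     (carrier S #>\<^bsub>S\<^esub> s) \<inter> (carrier S #>\<^bsub>S\<^esub> t) \<noteq> {})"

text \<open>
  \<open>G\<close> is a group of fractions of \<open>S\<close>, where \<open>S\<close> is contained in \<open>G\<close> by means of the embedding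
  \<open>\<iota>\<close>. Such a pair is determined by \<open>S\<close> up to isomorphism.
\<close>

definition group_of_fractions ::
    "('s, 'm) monoid_scheme \<Rightarrow> ('g, 'n) monoid_scheme \<Rightarrow> ('s \<Rightarrow> 'g) \<Rightarrow> bool" where
  "group_of_fractions S G \<iota> \<longleftrightarrow>
     group G \<and> \<iota> \<in> hom S G \<and> inj_on \<iota> (carrier S) \<and>
     (\<forall>g \<in> carrier G.
        (\<exists>a \<in> carrier S. \<exists>b \<in> carrier S. g = inv\<^bsub>G\<^esub> (\<iota> a) \<otimes>\<^bsub>G\<^esub> \<iota> b) \<and>
        (\<exists>c \<in> carrier S. \<exists>d \<in> carrier S. g = \<iota> c \<otimes>\<^bsub>G\<^esub> inv\<^bsub>G\<^esub> (\<iota> d)))"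

text \<open>
  The elements of the semigroup algebra are the finitely supported functions from \<open>S\<close> to \<open>F\<close>,
  extended by zero outside the carrier of \<open>S\<close>; the function \<open>f\<close> stands for the formal linear
  combination of the elements \<open>s\<close> of \<open>S\<close> with coefficients \<open>f s\<close>. The field \<open>one\<close> is the
  identity of the algebra if \<open>S\<close> is a monoid, and otherwise has no meaning.
\<close>

definition supp :: "('f, 'n) ring_scheme \<Rightarrow> ('s \<Rightarrow> 'f) \<Rightarrow> 's set" where
  "supp F f = {s. f s \<noteq> \<zero>\<^bsub>F\<^esub>}"

definition semigroup_algebra ::
    "('f, 'n) ring_scheme \<Rightarrow> ('s, 'm) monoid_scheme \<Rightarrow> ('s \<Rightarrow> 'f) ring" where
  "semigroup_algebra F S =
     \<lparr>carrier = {f. range f \<subseteq> carrier F \<and> finite (supp F f) \<and> supp F f \<subseteq> carrier S},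
      mult = (\<lambda>f g s. \<Oplus>\<^bsub>F\<^esub>p \<in> {(t, u). t \<in> supp F f \<and> u \<in> supp F g \<and> t \<otimes>\<^bsub>S\<^esub> u = s}.
                         f (fst p) \<otimes>\<^bsub>F\<^esub> g (snd p)),
      one = (\<lambda>s. if s = \<one>\<^bsub>S\<^esub> then \<one>\<^bsub>F\<^esub> else \<zero>\<^bsub>F\<^esub>),
      zero = (\<lambda>s. \<zero>\<^bsub>F\<^esub>),
      add = (\<lambda>f g s. f s \<oplus>\<^bsub>F\<^esub> g s)\<rparr>"

definition commutative :: "('r, 'm) ring_scheme \<Rightarrow> bool" where
  "commutative R \<longleftrightarrow> (\<forall>a \<in> carrier R. \<forall>b \<in> carrier R. a \<otimes>\<^bsub>R\<^esub> b = b \<otimes>\<^bsub>R\<^esub> a)"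

definition center :: "('r, 'm) ring_scheme \<Rightarrow> 'r set" where
  "center R = {z \<in> carrier R. \<forall>r \<in> carrier R. z \<otimes>\<^bsub>R\<^esub> r = r \<otimes>\<^bsub>R\<^esub> z}"

definition centrally_essential :: "('r, 'm) ring_scheme \<Rightarrow> bool" where
  "centrally_essential R \<longleftrightarrow> commutative R \<or>
     (\<forall>a \<in> carrier R - center R.
        \<exists>x \<in> center R - {\<zero>\<^bsub>R\<^esub>}. \<exists>y \<in> center R - {\<zero>\<^bsub>R\<^esub>}. a \<otimes>\<^bsub>R\<^esub> x = y)"

definition char_zero :: "('f, 'n) ring_scheme \<Rightarrow> bool" where
  "char_zero F \<longleftrightarrow> (\<forall>n::nat. n > 0 \<longrightarrow> [n] \<cdot>\<^bsub>F\<^esub> \<one>\<^bsub>F\<^esub> \<noteq> \<zero>\<^bsub>F\<^esub>)"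

end

theory Submission
  imports Defs
begin

text \<open>If \<open>s \<in> S\<close> is not central, then \<open>s x = y\<close> with non-zero central \<open>x\<close> and \<open>y\<close>. Comparing supports in \<open>t y = y t\<close> gives both Ore
  conditions, so that the group of fractions \<open>G\<close> exists. An element commuting with \<open>S\<close> commutes
  with \<open>G\<close>, hence the center of \<open>FS\<close> consists of the class functions of \<open>G\<close> supported on \<open>S\<close>. The
  supports of \<open>x\<close> and \<open>y\<close> are therefore finite and closed under conjugation, so \<open>s\<close> has finitely many
  conjugates. As this holds for all \<open>s\<close>, every element of \<open>G\<close> has a central power, and elements of
  \<open>FG\<close> can be brought into \<open>FS\<close> and back by central denominators taken from \<open>S\<close>.

  For the second part a semigroup in which all products of three elements vanish suffices.\<close>

section \<open>Groups of fractions\<close>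

text \<open>\<open>S\<close> need not have an identity, so the group has to be built from the Ore
  conditions alone, and evaluation at 1 is replaced by evaluation at arbitrary elements of
  \<open>S\<close>. The passage between FS and FG needs denominators that are central, since
  multiplication by a non-central element need not preserve the center. Finitely many elements of G
  always have a common denominator s in \<open>S\<close>; for k > 0 the power s^k is one as well,
  and the finiteness of the conjugacy classes makes some such power central. When FG is the algebra
  known to be centrally essential, this finiteness comes from FG itself, because G is a group of
  fractions of itself. For the second part a cancellative semigroup cannot serve: group algebras in
  characteristic zero are semiprime, and a centrally essential semiprime ring is commutative. This
  is why the example is made of nilpotent elements.\<close>

lemma (in mult_semigroup) right_ore_iff:
  "right_ore S \<longleftrightarrow>
     (\<forall>s\<in>carrier S. \<forall>t\<in>carrier S. \<exists>x\<in>carrier S. \<exists>y\<in>carrier S. s \<otimes> x = t \<otimes> y)"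
  unfolding right_ore_def l_coset_def by blast

lemma (in mult_semigroup) left_ore_iff:
  "left_ore S \<longleftrightarrow>
     (\<forall>s\<in>carrier S. \<forall>t\<in>carrier S. \<exists>x\<in>carrier S. \<exists>y\<in>carrier S. x \<otimes> s = y \<otimes> t)"
  unfolding left_ore_def r_coset_def by blast

locale ore_semigroup = cancellative_semigroup +
  assumes right_ore: "right_ore S"
    and left_ore: "left_ore S"
begin

text \<open>The group element \<open>c\<inverse> d\<close> acts on \<open>S\<close> partially by left multiplication, and is represented by the
  graph of this action. The composition of two such graphs is only contained in the graph of the
  product, but by the Ore conditions it is non-empty, and distinct graphs are disjoint.\<close>

definition left_frac :: "'a \<Rightarrow> 'a \<Rightarrow> ('a \<times> 'a) set" where
  "left_frac c d = {(s, t). s \<in> carrier S \<and> t \<in> carrier S \<and> c \<otimes> t = d \<otimes> s}"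

definition fractions :: "('a \<times> 'a) set set" where
  "fractions = {left_frac c d | c d. c \<in> carrier S \<and> d \<in> carrier S}"

text \<open>\<open>O\<close> applies its left argument first, so \<open>B O A\<close> acts by
  \<open>B\<close> and then by \<open>A\<close>, as left multiplication by the product of
  \<open>A\<close> and \<open>B\<close> should; hence the reversed order of the factors.\<close>

definition fraction_group :: "('a \<times> 'a) set monoid" where
  "fraction_group =
     \<lparr>carrier = fractions,
      mult = (\<lambda>A B. THE C. C \<in> fractions \<and> B O A \<subseteq> C),
      one = Id_on (carrier S)\<rparr>"

lemma right_oreE:
  assumes "s \<in> carrier S" "t \<in> carrier S"
  obtains x y where "x \<in> carrier S" "y \<in> carrier S" "s \<otimes> x = t \<otimes> y"
  using right_ore assms unfolding right_ore_iff by blast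

lemma left_oreE:
  assumes "s \<in> carrier S" "t \<in> carrier S"
  obtains x y where "x \<in> carrier S" "y \<in> carrier S" "x \<otimes> s = y \<otimes> t"
  using left_ore assms unfolding left_ore_iff by blast

lemma left_frac_in_fractions [intro]:
  "c \<in> carrier S \<Longrightarrow> d \<in> carrier S \<Longrightarrow> left_frac c d \<in> fractions"
  unfolding fractions_def by blast

lemma fractionsE:
  assumes "A \<in> fractions"
  obtains c d where "c \<in> carrier S" "d \<in> carrier S" "A = left_frac c d"
  using assms unfolding fractions_def by blast

lemma fractions_in_carrier:
  assumes "A \<in> fractions" "(s, t) \<in> A"
  shows "s \<in> carrier S" "t \<in> carrier S"
  using assms unfolding fractions_def left_frac_def by auto

lemma fractions_nonempty:
  assumes "A \<in> fractions"
  obtains s t where "(s, t) \<in> A"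
proof -
  obtain c d where cd: "c \<in> carrier S" "d \<in> carrier S" "A = left_frac c d"
    using assms by (rule fractionsE)
  obtain t s where "t \<in> carrier S" "s \<in> carrier S" "c \<otimes> t = d \<otimes> s"
    using cd(1,2) by (rule right_oreE)
  then show thesis using that cd(3) unfolding left_frac_def by blast
qed

text \<open>Left and right multiplications commute. Together with the right Ore condition this moves
  points of different graphs to a common place.\<close>

lemma fractions_scale:
  assumes "A \<in> fractions" "(s, t) \<in> A" "x \<in> carrier S"
  shows "(s \<otimes> x, t \<otimes> x) \<in> A"
proof -
  obtain c d where cd: "c \<in> carrier S" "d \<in> carrier S" "A = left_frac c d"
    using assms(1) by (rule fractionsE)
  have st: "s \<in> carrier S" "t \<in> carrier S" "c \<otimes> t = d \<otimes> s"
    using assms(2) cd(3) by (auto simp: left_frac_def)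
  have "c \<otimes> (t \<otimes> x) = d \<otimes> (s \<otimes> x)"
    using cd st assms(3) by (simp flip: m_assoc)
  then show ?thesis using cd st assms(3) by (simp add: left_frac_def m_closed)
qed

text \<open>The left Ore condition brings both fractions to the common denominator
  \<open>x \<otimes> c = y \<otimes> c'\<close>. Cancelling \<open>s\<close> at the common point
  shows that the numerators \<open>x \<otimes> d\<close> and \<open>y \<otimes> d'\<close> agree as
  well, and at any other point of the first graph cancelling \<open>y\<close> yields the equation of
  the second.\<close>

lemma left_frac_subset:
  assumes c: "c \<in> carrier S" "d \<in> carrier S" "c' \<in> carrier S" "d' \<in> carrier S"
    and p: "p \<in> left_frac c d" "p \<in> left_frac c' d'"
  shows "left_frac c d \<subseteq> left_frac c' d'"
proof
  fix r assume r: "r \<in> left_frac c d"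
  obtain s t where st: "p = (s, t)" "s \<in> carrier S" "t \<in> carrier S"
      "c \<otimes> t = d \<otimes> s" "c' \<otimes> t = d' \<otimes> s"
    using p unfolding left_frac_def by auto
  obtain s' t' where r': "r = (s', t')" "s' \<in> carrier S" "t' \<in> carrier S" "c \<otimes> t' = d \<otimes> s'"
    using r unfolding left_frac_def by auto
  obtain x y where xy: "x \<in> carrier S" "y \<in> carrier S" "x \<otimes> c = y \<otimes> c'"
    using c(1,3) by (rule left_oreE)
  have "(x \<otimes> d) \<otimes> s = x \<otimes> (c \<otimes> t)"
    using c st xy(1,2) by (simp only: m_assoc)
  also have "\<dots> = (x \<otimes> c) \<otimes> t"
    using c st(1-3) xy(1,2) by (simp only: m_assoc)
  also have "\<dots> = y \<otimes> (c' \<otimes> t)"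
    using c st(1-3) xy by (simp only: m_assoc)
  also have "\<dots> = (y \<otimes> d') \<otimes> s"
    using c st xy(1,2) by (simp only: m_assoc)
  finally have *: "x \<otimes> d = y \<otimes> d'"
    using c st xy by (meson m_closed r_cancel)
  have "y \<otimes> (c' \<otimes> t') = (x \<otimes> c) \<otimes> t'"
    using c r' xy by (simp only: m_assoc)
  also have "\<dots> = (x \<otimes> d) \<otimes> s'"
    using c r' xy(1,2) by (simp only: m_assoc)
  also have "\<dots> = y \<otimes> (d' \<otimes> s')"
    using c r' xy(1,2) by (simp only: * m_assoc)
  finally have "c' \<otimes> t' = d' \<otimes> s'"
    using c r' xy by (meson m_closed l_cancel)
  then show "r \<in> left_frac c' d'" using r' by (simp add: left_frac_def)
qed

text \<open>Every identity in the group is thereby reduced to exhibiting a single pair that lies in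
  both sides.\<close>

lemma fractions_eqI:
  assumes "A \<in> fractions" "B \<in> fractions" "p \<in> A" "p \<in> B"
  shows "A = B"
proof -
  obtain c d where cd: "c \<in> carrier S" "d \<in> carrier S" "A = left_frac c d"
    using assms(1) by (rule fractionsE)
  obtain c' d' where cd': "c' \<in> carrier S" "d' \<in> carrier S" "B = left_frac c' d'"
    using assms(2) by (rule fractionsE)
  show ?thesis
    using left_frac_subset assms(3,4) cd cd' by blast
qed

text \<open>Formally, \<open>p \<otimes> c = q \<otimes> f\<close> says f c^-1 = q^-1 p, so that
  (e^-1 f) (c^-1 d) = (q e)^-1 (p d).\<close>

lemma comp_subset_fraction:
  assumes "A \<in> fractions" "B \<in> fractions"
  obtains C where "C \<in> fractions" "A O B \<subseteq> C"
proof -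
  obtain c d where cd: "c \<in> carrier S" "d \<in> carrier S" "A = left_frac c d"
    using assms(1) by (rule fractionsE)
  obtain e f where ef: "e \<in> carrier S" "f \<in> carrier S" "B = left_frac e f"
    using assms(2) by (rule fractionsE)
  obtain p q where pq: "p \<in> carrier S" "q \<in> carrier S" "p \<otimes> c = q \<otimes> f"
    using cd(1) ef(2) by (rule left_oreE)
  have "A O B \<subseteq> left_frac (q \<otimes> e) (p \<otimes> d)"
  proof clarify
    fix s u t assume "(s, t) \<in> A" "(t, u) \<in> B"
    then have *: "s \<in> carrier S" "t \<in> carrier S" "u \<in> carrier S" "c \<otimes> t = d \<otimes> s" "e \<otimes> u = f \<otimes> t"
      using cd ef by (auto simp: left_frac_def)
    have "q \<otimes> e \<otimes> u = (q \<otimes> f) \<otimes> t"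
      using * cd(1,2) ef(1,2) pq by (simp add: m_assoc)
    also have "\<dots> = p \<otimes> d \<otimes> s"
      using * cd(1,2) ef(1,2) pq(1,2) by (simp flip: pq(3) add: m_assoc)
    finally show "(s, u) \<in> left_frac (q \<otimes> e) (p \<otimes> d)"
      using * by (simp add: left_frac_def)
  qed
  then show thesis
    using that[of "left_frac (q \<otimes> e) (p \<otimes> d)"] cd ef pq m_closed by blast
qed

text \<open>The right Ore condition makes the end point of a pair of \<open>A\<close> meet the
  starting point of a pair of \<open>B\<close> after scaling.\<close>

lemma comp_nonempty:
  assumes "A \<in> fractions" "B \<in> fractions"
  obtains p where "p \<in> A O B"
proof -
  obtain s t where st: "(s, t) \<in> A" using assms(1) by (rule fractions_nonempty)
  obtain t' u where tu: "(t', u) \<in> B" using assms(2) by (rule fractions_nonempty)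
  obtain x y where xy: "x \<in> carrier S" "y \<in> carrier S" "t \<otimes> x = t' \<otimes> y"
    using fractions_in_carrier assms st tu by (meson right_oreE)
  have "(s \<otimes> x, u \<otimes> y) \<in> A O B"
    using fractions_scale[OF assms(1) st xy(1)] fractions_scale[OF assms(2) tu xy(2)] xy(3)
    by auto
  then show thesis by (rule that)
qed

lemma fraction_mult:
  assumes "A \<in> fractions" "B \<in> fractions"
  shows "A \<otimes>\<^bsub>fraction_group\<^esub> B \<in> fractions" "B O A \<subseteq> A \<otimes>\<^bsub>fraction_group\<^esub> B"
proof -
  obtain C where C: "C \<in> fractions" "B O A \<subseteq> C"
    using assms by (meson comp_subset_fraction)
  obtain p where p: "p \<in> B O A" using assms by (meson comp_nonempty)
  have "A \<otimes>\<^bsub>fraction_group\<^esub> B = C"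
    unfolding fraction_group_def using C p
    by simp (rule the_equality, simp, meson fractions_eqI subsetD)
  then show "A \<otimes>\<^bsub>fraction_group\<^esub> B \<in> fractions" "B O A \<subseteq> A \<otimes>\<^bsub>fraction_group\<^esub> B"
    using C by auto
qed

lemma fraction_mult_eqI:
  assumes "A \<in> fractions" "B \<in> fractions" "C \<in> fractions" "p \<in> B O A" "p \<in> C"
  shows "A \<otimes>\<^bsub>fraction_group\<^esub> B = C"
  using fractions_eqI fraction_mult assms by blast

lemma left_frac_self:
  assumes "c \<in> carrier S"
  shows "left_frac c c = Id_on (carrier S)"
  using assms l_cancel unfolding left_frac_def Id_on_def by auto

lemma converse_left_frac: "(left_frac c d)\<inverse> = left_frac d c"
  unfolding left_frac_def by auto

lemma Id_on_in_fractions: "Id_on (carrier S) \<in> fractions"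
  using left_frac_self nonempty by (metis equals0I left_frac_in_fractions)

lemma converse_in_fractions: "A \<in> fractions \<Longrightarrow> A\<inverse> \<in> fractions"
  by (metis converse_left_frac fractionsE left_frac_in_fractions)

lemma converse_mult:
  assumes "A \<in> fractions"
  shows "A\<inverse> \<otimes>\<^bsub>fraction_group\<^esub> A = Id_on (carrier S)"
proof -
  obtain s t where st: "(s, t) \<in> A" using assms by (rule fractions_nonempty)
  show ?thesis
    by (rule fraction_mult_eqI[where p = "(s, s)"])
      (use assms st converse_in_fractions Id_on_in_fractions fractions_in_carrier in auto)
qed

lemma group_fraction_group: "group fraction_group"
proof (rule groupI)
  have carr: "carrier fraction_group = fractions" and one: "\<one>\<^bsub>fraction_group\<^esub> = Id_on (carrier S)"
    by (simp_all add: fraction_group_def)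
  fix A assume A: "A \<in> carrier fraction_group"
  show "\<one>\<^bsub>fraction_group\<^esub> \<otimes>\<^bsub>fraction_group\<^esub> A = A"
  proof -
    obtain s t where st: "(s, t) \<in> A" using A unfolding carr by (rule fractions_nonempty)
    then have "(s, t) \<in> A O Id_on (carrier S)" 
      using A carr fractions_in_carrier by auto
    then show ?thesis
      using fraction_mult_eqI A carr one Id_on_in_fractions st by metis
  qed
  show "\<exists>B\<in>carrier fraction_group. B \<otimes>\<^bsub>fraction_group\<^esub> A = \<one>\<^bsub>fraction_group\<^esub>"
    using A carr one converse_in_fractions converse_mult by metis
  fix B assume B: "B \<in> carrier fraction_group"
  show "A \<otimes>\<^bsub>fraction_group\<^esub> B \<in> carrier fraction_group"
    using A B carr fraction_mult by metis
  fix C assume C: "C \<in> carrier fraction_group"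
  obtain p q where pq: "(p, q) \<in> C O B"
    using B C carr comp_nonempty[of C B] by (metis surj_pair)
  have CB: "C O B \<subseteq> B \<otimes>\<^bsub>fraction_group\<^esub> C" "B \<otimes>\<^bsub>fraction_group\<^esub> C \<in> fractions"
    using B C carr fraction_mult by auto
  have BA: "B O A \<subseteq> A \<otimes>\<^bsub>fraction_group\<^esub> B" "A \<otimes>\<^bsub>fraction_group\<^esub> B \<in> fractions"
    using B A carr fraction_mult by auto
  obtain q' r where qr: "(q', r) \<in> A" using A unfolding carr by (rule fractions_nonempty)
  obtain m where m: "(p, m) \<in> C" "(m, q) \<in> B" using pq by auto
  obtain x y where xy: "x \<in> carrier S" "y \<in> carrier S" "q \<otimes> x = q' \<otimes> y"
    using m(2) qr A B unfolding carr by (meson fractions_in_carrier right_oreE)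
  \<comment> \<open>The three pairs form a chain from \<open>p \<otimes> x\<close> to
    \<open>r \<otimes> y\<close> through \<open>C\<close>, \<open>B\<close> and \<open>A\<close>,
    and the pair of its end points lies in both bracketings of the product.\<close>
  have *: "(p \<otimes> x, m \<otimes> x) \<in> C" "(m \<otimes> x, q \<otimes> x) \<in> B" "(q \<otimes> x, r \<otimes> y) \<in> A"
    using fractions_scale m qr A B C xy unfolding carr by (blast, blast, metis)
  show "A \<otimes>\<^bsub>fraction_group\<^esub> B \<otimes>\<^bsub>fraction_group\<^esub> C = A \<otimes>\<^bsub>fraction_group\<^esub> (B \<otimes>\<^bsub>fraction_group\<^esub> C)"
  proof (rule fraction_mult_eqI[where p = "(p \<otimes> x, r \<otimes> y)"])
    show "(p \<otimes> x, r \<otimes> y) \<in> C O (A \<otimes>\<^bsub>fraction_group\<^esub> B)"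
      using * BA(1) by blast
    show "(p \<otimes> x, r \<otimes> y) \<in> A \<otimes>\<^bsub>fraction_group\<^esub> (B \<otimes>\<^bsub>fraction_group\<^esub> C)"
      using * CB fraction_mult(2) A carr by blast
    show "A \<otimes>\<^bsub>fraction_group\<^esub> (B \<otimes>\<^bsub>fraction_group\<^esub> C) \<in> fractions"
      using A CB(2) unfolding carr by (rule fraction_mult(1))
  qed (use C carr BA(2) in simp_all)
qed (simp add: fraction_group_def Id_on_in_fractions)

section \<open>The embedding of the semigroup into its group of fractions\<close>

definition fraction_embed :: "'a \<Rightarrow> ('a \<times> 'a) set" where
  "fraction_embed a = {(s, a \<otimes> s) | s. s \<in> carrier S}"

text \<open>Formally a = c^-1 (c a); as there may be no identity to take as denominator, an
  arbitrary \<open>c\<close> is used.\<close>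

lemma fraction_embed_eq_left_frac:
  assumes "a \<in> carrier S" "c \<in> carrier S"
  shows "fraction_embed a = left_frac c (c \<otimes> a)"
proof -
  have "c \<otimes> t = c \<otimes> a \<otimes> s \<longleftrightarrow> t = a \<otimes> s" if "s \<in> carrier S" "t \<in> carrier S" for s t
    using assms that by (metis l_cancel m_assoc m_closed)
  then show ?thesis
    using assms m_closed unfolding fraction_embed_def left_frac_def by auto
qed

lemma fraction_embed_in_fractions: "a \<in> carrier S \<Longrightarrow> fraction_embed a \<in> fractions"
  using fraction_embed_eq_left_frac m_closed by (metis left_frac_in_fractions)

lemma inv_fraction_group:
  assumes "A \<in> fractions"
  shows "inv\<^bsub>fraction_group\<^esub> A = A\<inverse>"
proof -
  interpret group fraction_group by (rule group_fraction_group)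
  have "A\<inverse> \<otimes>\<^bsub>fraction_group\<^esub> A = \<one>\<^bsub>fraction_group\<^esub>"
    using converse_mult[OF assms] by (simp add: fraction_group_def)
  then show ?thesis
    by (rule inv_equality)
      (use assms converse_in_fractions in \<open>simp_all add: fraction_group_def\<close>)
qed

lemma group_of_fractions_fraction_group: "group_of_fractions S fraction_group fraction_embed"
  unfolding group_of_fractions_def
proof (intro conjI ballI)
  have carr: "carrier fraction_group = fractions"
    by (simp add: fraction_group_def)
  \<comment> \<open>The test point that stands in for an identity: by right cancellation
    \<open>a\<close> can be recovered from \<open>a \<otimes> e\<close>.\<close>
  obtain e where e: "e \<in> carrier S" using nonempty by blast
  show "group fraction_group" by (rule group_fraction_group)
  show "fraction_embed \<in> hom S fraction_group"
  proof (rule homI)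
    fix a b assume ab: "a \<in> carrier S" "b \<in> carrier S"
    show "fraction_embed (a \<otimes> b) = fraction_embed a \<otimes>\<^bsub>fraction_group\<^esub> fraction_embed b"
    proof (rule sym, rule fraction_mult_eqI[where p = "(e, (a \<otimes> b) \<otimes> e)"])
      have "(e, a \<otimes> (b \<otimes> e)) \<in> fraction_embed b O fraction_embed a"
        using ab e m_closed unfolding fraction_embed_def by blast
      then show "(e, a \<otimes> b \<otimes> e) \<in> fraction_embed b O fraction_embed a" using ab e by (simp add: m_assoc)
    qed (use ab e fraction_embed_in_fractions m_closed in \<open>auto simp: fraction_embed_def\<close>)
  qed (simp add: carr fraction_embed_in_fractions)
  show "inj_on fraction_embed (carrier S)"
  proof (rule inj_onI)
    fix a b assume ab: "a \<in> carrier S" "b \<in> carrier S" "fraction_embed a = fraction_embed b"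
    have "(e, a \<otimes> e) \<in> fraction_embed b" unfolding ab(3)[symmetric] using e by (auto simp: fraction_embed_def)
    then show "a = b" using ab e r_cancel by (auto simp: fraction_embed_def)
  qed
  fix g assume "g \<in> carrier fraction_group"
  then have g: "g \<in> fractions" using carr by simp
  then obtain c d where cd: "c \<in> carrier S" "d \<in> carrier S" "g = left_frac c d"
    by (rule fractionsE)
  obtain s t where st: "(s, t) \<in> g" using g by (rule fractions_nonempty)
  have st': "s \<in> carrier S" "t \<in> carrier S" using g st fractions_in_carrier by auto
  have "c \<otimes> t = d \<otimes> s" using st cd(3) by (simp add: left_frac_def)
  then have "(s, t) \<in> fraction_embed d O (fraction_embed c)\<inverse>"
    using st' unfolding fraction_embed_def by auto
  then have "inv\<^bsub>fraction_group\<^esub> (fraction_embed c) \<otimes>\<^bsub>fraction_group\<^esub> fraction_embed d = g"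
    using fraction_mult_eqI g st cd inv_fraction_group fraction_embed_in_fractions converse_in_fractions
    by metis
  then show "\<exists>a\<in>carrier S. \<exists>b\<in>carrier S. g = inv\<^bsub>fraction_group\<^esub> (fraction_embed a) \<otimes>\<^bsub>fraction_group\<^esub> fraction_embed b"
    using cd by blast
  \<comment> \<open>Since \<open>g\<close> sends \<open>s\<close> to \<open>t\<close>, it should be
    t s^-1; the path \<open>s \<otimes> e\<close>, \<open>e\<close>, \<open>t \<otimes> e\<close>
    confirms this at one point.\<close>
  have "(s \<otimes> e, t \<otimes> e) \<in> (fraction_embed s)\<inverse> O fraction_embed t"
    using e unfolding fraction_embed_def by auto
  moreover have "(s \<otimes> e, t \<otimes> e) \<in> g" using fractions_scale g st e by blast
  ultimately have "fraction_embed t \<otimes>\<^bsub>fraction_group\<^esub> inv\<^bsub>fraction_group\<^esub> (fraction_embed s) = g"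
    using fraction_mult_eqI g st' inv_fraction_group fraction_embed_in_fractions converse_in_fractions
    by metis
  then show "\<exists>c\<in>carrier S. \<exists>d\<in>carrier S. g = fraction_embed c \<otimes>\<^bsub>fraction_group\<^esub> inv\<^bsub>fraction_group\<^esub> (fraction_embed d)"
    using st' by blast
qed

end

section \<open>Semigroup algebras\<close>

text \<open>A commutative ring has no element outside its center, so there the second alternative
  holds vacuously. This spares a separate commutative case throughout.\<close>

lemma centrally_essential_iff:
  "centrally_essential R \<longleftrightarrow>
     (\<forall>a \<in> carrier R - center R.
        \<exists>x \<in> center R - {\<zero>\<^bsub>R\<^esub>}. \<exists>y \<in> center R - {\<zero>\<^bsub>R\<^esub>}. a \<otimes>\<^bsub>R\<^esub> x = y)"
  unfolding centrally_essential_def commutative_def center_def by blast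

text \<open>Central essentiality speaks only of products and of being non-zero. Surjectivity carries
  the center into the center, so a preimage of a non-central element is non-central.\<close>

lemma centrally_essential_image:
  assumes R: "centrally_essential R"
    and surj: "\<phi> ` carrier R = carrier R'"
    and mult: "\<And>a b. a \<in> carrier R \<Longrightarrow> b \<in> carrier R \<Longrightarrow> \<phi> (a \<otimes>\<^bsub>R\<^esub> b) = \<phi> a \<otimes>\<^bsub>R'\<^esub> \<phi> b"
    and zero: "\<And>a. a \<in> carrier R \<Longrightarrow> \<phi> a = \<zero>\<^bsub>R'\<^esub> \<Longrightarrow> a = \<zero>\<^bsub>R\<^esub>"
  shows "centrally_essential R'"
  unfolding centrally_essential_iff
proof
  have center: "\<phi> z \<in> center R'" if z: "z \<in> center R" for z
    unfolding center_def
  proof (intro CollectI conjI ballI)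
    show "\<phi> z \<in> carrier R'" using z surj by (auto simp: center_def)
    fix r assume "r \<in> carrier R'"
    then obtain s where s: "s \<in> carrier R" "r = \<phi> s" using surj by blast
    then show "\<phi> z \<otimes>\<^bsub>R'\<^esub> r = r \<otimes>\<^bsub>R'\<^esub> \<phi> z"
      using z mult by (metis (mono_tags, lifting) center_def mem_Collect_eq)
  qed
  fix a' assume a': "a' \<in> carrier R' - center R'"
  then obtain a where a: "a \<in> carrier R" "a' = \<phi> a" using surj by blast
  then obtain x where x: "x \<in> center R" "x \<noteq> \<zero>\<^bsub>R\<^esub>" "a \<otimes>\<^bsub>R\<^esub> x \<in> center R" "a \<otimes>\<^bsub>R\<^esub> x \<noteq> \<zero>\<^bsub>R\<^esub>"
    using R a' center unfolding centrally_essential_iff by blast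
  then have "\<phi> x \<in> center R' - {\<zero>\<^bsub>R'\<^esub>}" "\<phi> (a \<otimes>\<^bsub>R\<^esub> x) \<in> center R' - {\<zero>\<^bsub>R'\<^esub>}"
    using center zero by (auto simp: center_def)
  then show "\<exists>x\<in>center R' - {\<zero>\<^bsub>R'\<^esub>}. \<exists>y\<in>center R' - {\<zero>\<^bsub>R'\<^esub>}. a' \<otimes>\<^bsub>R'\<^esub> x = y"
    using a x(1) mult by (metis (no_types, lifting) center_def mem_Collect_eq)
qed

section \<open>Convolution of finitely supported functions\<close>

definition single :: "('f, 'n) ring_scheme \<Rightarrow> 's \<Rightarrow> 's \<Rightarrow> 'f" where
  "single F s = (\<lambda>t. if t = s then \<one>\<^bsub>F\<^esub> else \<zero>\<^bsub>F\<^esub>)"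

lemma mem_supp [simp]: "s \<in> supp F f \<longleftrightarrow> f s \<noteq> \<zero>\<^bsub>F\<^esub>"
  by (simp add: supp_def)

lemma carrier_semigroup_algebra:
  "f \<in> carrier (semigroup_algebra F S) \<longleftrightarrow>
     range f \<subseteq> carrier F \<and> finite (supp F f) \<and> supp F f \<subseteq> carrier S"
  by (simp add: semigroup_algebra_def)

lemma zero_semigroup_algebra: "\<zero>\<^bsub>semigroup_algebra F S\<^esub> = (\<lambda>s. \<zero>\<^bsub>F\<^esub>)"
  by (simp add: semigroup_algebra_def)

lemma semigroup_algebra_nonzeroE:
  assumes "f \<noteq> \<zero>\<^bsub>semigroup_algebra F S\<^esub>"
  obtains s where "f s \<noteq> \<zero>\<^bsub>F\<^esub>"
  using assms unfolding zero_semigroup_algebra by blast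

context field
begin

lemma semigroup_algebra_value:
  "f \<in> carrier (semigroup_algebra R S) \<Longrightarrow> f s \<in> carrier R"
  by (auto simp: carrier_semigroup_algebra)

lemma single_nonzero_iff [simp]: "single R s t \<noteq> \<zero> \<longleftrightarrow> t = s"
  by (simp add: single_def)

lemma single_in_carrier:
  "s \<in> carrier S \<Longrightarrow> single R s \<in> carrier (semigroup_algebra R S)"
proof -
  have "supp R (single R s) = {s}" by (auto simp: single_def split: if_splits)
  then show "s \<in> carrier S \<Longrightarrow> ?thesis" 
    by (auto simp: carrier_semigroup_algebra single_def)
qed

lemma semigroup_algebra_mult_nonzeroE:
  assumes "(f \<otimes>\<^bsub>semigroup_algebra R S\<^esub> g) s \<noteq> \<zero>"
  obtains t u where "f t \<noteq> \<zero>" "g u \<noteq> \<zero>" "s = t \<otimes>\<^bsub>S\<^esub> u"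
proof (rule ccontr)
  assume "\<not> thesis"
  then have P: "{(t, u). t \<in> supp R f \<and> u \<in> supp R g \<and> t \<otimes>\<^bsub>S\<^esub> u = s} = {}"
    using that by auto
  have "(f \<otimes>\<^bsub>semigroup_algebra R S\<^esub> g) s =
      (\<Oplus>p\<in>{(t, u). t \<in> supp R f \<and> u \<in> supp R g \<and> t \<otimes>\<^bsub>S\<^esub> u = s}. f (fst p) \<otimes> g (snd p))"
    by (simp add: semigroup_algebra_def)
  also have "\<dots> = \<zero>" unfolding P by simp
  finally show False using assms by simp
qed

text \<open>Uniqueness of the factorization within the supports leaves at most one term in the
  convolution sum, and none if one of the two coefficients vanishes. With a basis vector as one
  factor, cancellation in the semigroup supplies the uniqueness.\<close>

lemma semigroup_algebra_mult_unique:
  assumes f: "f \<in> carrier (semigroup_algebra R S)" and g: "g \<in> carrier (semigroup_algebra R S)"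
    and unique: "\<And>t' u'. f t' \<noteq> \<zero> \<Longrightarrow> g u' \<noteq> \<zero> \<Longrightarrow> t' \<otimes>\<^bsub>S\<^esub> u' = t \<otimes>\<^bsub>S\<^esub> u \<Longrightarrow> t' = t \<and> u' = u"
  shows "(f \<otimes>\<^bsub>semigroup_algebra R S\<^esub> g) (t \<otimes>\<^bsub>S\<^esub> u) = f t \<otimes> g u"
proof -
  let ?P = "{(t', u'). t' \<in> supp R f \<and> u' \<in> supp R g \<and> t' \<otimes>\<^bsub>S\<^esub> u' = t \<otimes>\<^bsub>S\<^esub> u}"
  have fg: "f t \<in> carrier R" "g u \<in> carrier R"
    using f g by (simp_all add: semigroup_algebra_value)
  have mult: "(f \<otimes>\<^bsub>semigroup_algebra R S\<^esub> g) (t \<otimes>\<^bsub>S\<^esub> u) = (\<Oplus>p\<in>?P. f (fst p) \<otimes> g (snd p))"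
    by (simp add: semigroup_algebra_def)
  show ?thesis
  proof (cases "f t = \<zero> \<or> g u = \<zero>")
    case True
    then have P: "?P = {}" using unique by auto
    show ?thesis unfolding mult P using True fg by auto
  next
    case False
    then have P: "?P = {(t, u)}" using unique by auto
    show ?thesis unfolding mult P using fg by simp
  qed
qed

text \<open>\<open>(h1, h2)\<close> and \<open>(k1, k2)\<close> are mutually inverse bijections
  between the index sets of the two convolution sums, matching them term by term. Swapping factors,
  transport along an isomorphism, conjugation and translation are all instances.\<close>

lemma semigroup_algebra_mult_eqI:
  fixes S :: "('s, 'm) monoid_scheme" and S' :: "('t, 'n) monoid_scheme"
  assumes f: "f \<in> carrier (semigroup_algebra R S)" and g: "g \<in> carrier (semigroup_algebra R S)"
    and forward: "\<And>t u. f t \<noteq> \<zero> \<Longrightarrow> g u \<noteq> \<zero> \<Longrightarrow> t \<otimes>\<^bsub>S\<^esub> u = s \<Longrightarrow>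
               h1 t u \<otimes>\<^bsub>S'\<^esub> h2 t u = s' \<and> k1 (h1 t u) (h2 t u) = t \<and> k2 (h1 t u) (h2 t u) = u \<and>
               f t \<otimes> g u = f' (h1 t u) \<otimes> g' (h2 t u) \<and> f' (h1 t u) \<noteq> \<zero> \<and> g' (h2 t u) \<noteq> \<zero>"
    and backward: "\<And>t u. f' t \<noteq> \<zero> \<Longrightarrow> g' u \<noteq> \<zero> \<Longrightarrow> t \<otimes>\<^bsub>S'\<^esub> u = s' \<Longrightarrow>
               k1 t u \<otimes>\<^bsub>S\<^esub> k2 t u = s \<and> h1 (k1 t u) (k2 t u) = t \<and> h2 (k1 t u) (k2 t u) = u \<and>
               f (k1 t u) \<noteq> \<zero> \<and> g (k2 t u) \<noteq> \<zero>"
  shows "(f \<otimes>\<^bsub>semigroup_algebra R S\<^esub> g) s = (f' \<otimes>\<^bsub>semigroup_algebra R S'\<^esub> g') s'"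
proof -
  let ?P = "{(t, u). t \<in> supp R f \<and> u \<in> supp R g \<and> t \<otimes>\<^bsub>S\<^esub> u = s}"
  let ?Q = "{(t, u). t \<in> supp R f' \<and> u \<in> supp R g' \<and> t \<otimes>\<^bsub>S'\<^esub> u = s'}"
  let ?h = "\<lambda>p. (h1 (fst p) (snd p), h2 (fst p) (snd p))"
  let ?w = "\<lambda>p. f' (fst p) \<otimes> g' (snd p)"
  have image: "?h ` ?P = ?Q"
  proof (intro equalityI subsetI)
    fix q assume "q \<in> ?Q"
    then obtain t u where q: "q = (t, u)" "f' t \<noteq> \<zero>" "g' u \<noteq> \<zero>" "t \<otimes>\<^bsub>S'\<^esub> u = s'" by auto
    have "q = ?h (k1 t u, k2 t u)" "(k1 t u, k2 t u) \<in> ?P"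
      using backward[OF q(2-4)] q(1) by auto
    then show "q \<in> ?h ` ?P" by blast
  qed (use forward in auto)
  have inj: "inj_on ?h ?P"
    by (rule inj_on_inverseI[where g = "\<lambda>q. (k1 (fst q) (snd q), k2 (fst q) (snd q))"]) (use forward in auto)
  have eq: "f t \<otimes> g u = ?w (?h (t, u))" if "(t, u) \<in> ?P" for t u
    using forward that by auto
  have closed: "?w \<in> ?h ` ?P \<rightarrow> carrier R"
  proof
    fix q assume "q \<in> ?h ` ?P"
    then obtain t u where "(t, u) \<in> ?P" "q = ?h (t, u)" by auto
    then show "?w q \<in> carrier R" using eq[of t u] f g by (metis m_closed semigroup_algebra_value)
  qed
  have "(f \<otimes>\<^bsub>semigroup_algebra R S\<^esub> g) s = (\<Oplus>p\<in>?P. f (fst p) \<otimes> g (snd p))"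
    by (simp add: semigroup_algebra_def)
  also have "\<dots> = (\<Oplus>p\<in>?P. ?w (?h p))"
  proof (rule finsum_cong')
    show "(\<lambda>p. ?w (?h p)) \<in> ?P \<rightarrow> carrier R" using closed by blast
  qed (use eq in auto)
  also have "\<dots> = (\<Oplus>q\<in>?h ` ?P. ?w q)"
    using closed inj by (rule finsum_reindex[symmetric])
  also have "\<dots> = (f' \<otimes>\<^bsub>semigroup_algebra R S'\<^esub> g') s'"
    unfolding image by (simp add: semigroup_algebra_def)
  finally show ?thesis .
qed

lemma in_center_if_supp_commutes:
  assumes f: "f \<in> carrier (semigroup_algebra R S)"
    and comm: "\<And>t u. f t \<noteq> \<zero> \<Longrightarrow> u \<in> carrier S \<Longrightarrow> t \<otimes>\<^bsub>S\<^esub> u = u \<otimes>\<^bsub>S\<^esub> t"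
  shows "f \<in> center (semigroup_algebra R S)"
  unfolding center_def
proof (intro CollectI conjI ballI)
  fix g assume g: "g \<in> carrier (semigroup_algebra R S)"
  then have supp: "u \<in> carrier S" if "g u \<noteq> \<zero>" for u
    using that by (auto simp: carrier_semigroup_algebra)
  show "f \<otimes>\<^bsub>semigroup_algebra R S\<^esub> g = g \<otimes>\<^bsub>semigroup_algebra R S\<^esub> f"
  proof
    fix s
    show "(f \<otimes>\<^bsub>semigroup_algebra R S\<^esub> g) s = (g \<otimes>\<^bsub>semigroup_algebra R S\<^esub> f) s"
    proof (rule semigroup_algebra_mult_eqI[OF f g, where ?h1.0 = "\<lambda>t u. u" and ?h2.0 = "\<lambda>t u. t"
          and ?k1.0 = "\<lambda>t u. u" and ?k2.0 = "\<lambda>t u. t"], goal_cases)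
      case (1 t u)
      then show ?case
        using comm[of t u] supp[of u] m_comm[OF semigroup_algebra_value[OF f] semigroup_algebra_value[OF g]]
        by simp
    next
      case (2 t u)
      then show ?case using comm[of u t] supp[of t] by simp
    qed
  qed
qed (rule f)

lemma centrally_essential_semigroup_algebra_iso:
  fixes S :: "('s, 'm) monoid_scheme" and T :: "('t, 'n) monoid_scheme"
  assumes ce: "centrally_essential (semigroup_algebra R T)"
    and hom: "h \<in> hom S T" and bij: "bij_betw h (carrier S) (carrier T)"
    and closed: "\<And>a b. a \<in> carrier S \<Longrightarrow> b \<in> carrier S \<Longrightarrow> a \<otimes>\<^bsub>S\<^esub> b \<in> carrier S"
  shows "centrally_essential (semigroup_algebra R S)"
proof -
  \<comment> \<open>Pulling functions back along \<open>h\<close> avoids summation over fibres. The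
    value zero off the carrier is required of elements of the algebra, while \<open>h\<close> is
    unconstrained there.\<close>
  define \<phi> where "\<phi> f s = (if s \<in> carrier S then f (h s) else \<zero>)" for f :: "'t \<Rightarrow> 'a" and s
  define k where "k = inv_into (carrier S) h"
  have kh: "k (h s) = s" if "s \<in> carrier S" for s
    using that bij unfolding k_def by (simp add: bij_betw_def)
  have hk: "h (k t) = t" "k t \<in> carrier S" if "t \<in> carrier T" for t
    using that bij unfolding k_def by (auto simp: bij_betw_def f_inv_into_f inv_into_into)
  have hT: "h s \<in> carrier T" if "s \<in> carrier S" for s
    using that bij by (auto simp: bij_betw_def)
  have supp: "t \<in> carrier T" if "f \<in> carrier (semigroup_algebra R T)" "f t \<noteq> \<zero>" for f t
    using that by (auto simp: carrier_semigroup_algebra)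
  show ?thesis
  proof (rule centrally_essential_image[OF ce, where \<phi> = \<phi>])
    show "\<phi> ` carrier (semigroup_algebra R T) = carrier (semigroup_algebra R S)"
    proof (intro equalityI subsetI)
      fix f assume "f \<in> \<phi> ` carrier (semigroup_algebra R T)"
      then obtain f' where f': "f' \<in> carrier (semigroup_algebra R T)" "f = \<phi> f'" by blast
      have "supp R f \<subseteq> k ` supp R f'"
      proof
        fix s assume "s \<in> supp R f"
        then have "s \<in> carrier S" "f' (h s) \<noteq> \<zero>"
          by (auto simp: f'(2) \<phi>_def split: if_splits)
        then show "s \<in> k ` supp R f'" by (intro image_eqI[of _ _ "h s"]) (simp_all add: kh)
      qed
      then have "finite (supp R f)"
        using f'(1) by (auto simp: carrier_semigroup_algebra intro: finite_subset)
      then show "f \<in> carrier (semigroup_algebra R S)"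
        using semigroup_algebra_value[OF f'(1)] unfolding f'(2) carrier_semigroup_algebra
        by (auto simp: \<phi>_def split: if_splits)
    next
      fix f assume f: "f \<in> carrier (semigroup_algebra R S)"
      define f' where "f' t = (if t \<in> carrier T then f (k t) else \<zero>)" for t
      have "supp R f' \<subseteq> h ` supp R f"
      proof
        fix t assume "t \<in> supp R f'"
        then have "t \<in> carrier T" "f (k t) \<noteq> \<zero>"
          by (auto simp: f'_def split: if_splits)
        then show "t \<in> h ` supp R f" by (intro image_eqI[of _ _ "k t"]) (simp_all add: hk)
      qed
      then have "finite (supp R f')"
        using f by (auto simp: carrier_semigroup_algebra intro: finite_subset)
      then have "f' \<in> carrier (semigroup_algebra R T)"
        using semigroup_algebra_value[OF f] unfolding carrier_semigroup_algebra
        by (auto simp: f'_def split: if_splits)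
      moreover have "f = \<phi> f'"
      proof
        fix s
        show "f s = \<phi> f' s"
          using f kh[of s] hT[of s] by (auto simp: \<phi>_def f'_def carrier_semigroup_algebra)
      qed
      ultimately show "f \<in> \<phi> ` carrier (semigroup_algebra R T)" by blast
    qed
  next
    fix f g assume fg: "f \<in> carrier (semigroup_algebra R T)" "g \<in> carrier (semigroup_algebra R T)"
    show "\<phi> (f \<otimes>\<^bsub>semigroup_algebra R T\<^esub> g) = \<phi> f \<otimes>\<^bsub>semigroup_algebra R S\<^esub> \<phi> g"
    proof
      fix s
      show "\<phi> (f \<otimes>\<^bsub>semigroup_algebra R T\<^esub> g) s = (\<phi> f \<otimes>\<^bsub>semigroup_algebra R S\<^esub> \<phi> g) s"
      proof (cases "s \<in> carrier S")
        case True
        have k_mult: "k (t \<otimes>\<^bsub>T\<^esub> u) = k t \<otimes>\<^bsub>S\<^esub> k u" if "t \<in> carrier T" "u \<in> carrier T" for t u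
          using that hk kh closed hom by (metis hom_mult)
        have "(f \<otimes>\<^bsub>semigroup_algebra R T\<^esub> g) (h s) = (\<phi> f \<otimes>\<^bsub>semigroup_algebra R S\<^esub> \<phi> g) s"
        proof (rule semigroup_algebra_mult_eqI[OF fg, where ?h1.0 = "\<lambda>t u. k t" and ?h2.0 = "\<lambda>t u. k u"
              and ?k1.0 = "\<lambda>t u. h t" and ?k2.0 = "\<lambda>t u. h u"], goal_cases)
          case (1 t u)
          then have "t \<in> carrier T" "u \<in> carrier T" using fg supp by auto
          then show ?case
            using 1 hk k_mult[of t u, symmetric] kh[OF True] by (simp add: \<phi>_def)
        next
          case (2 t u)
          then have "t \<in> carrier S" "u \<in> carrier S" by (auto simp: \<phi>_def split: if_splits)
          then show ?case using 2 kh hom by (auto simp: \<phi>_def hom_mult)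
        qed
        then show ?thesis using True by (simp add: \<phi>_def)
      next
        case False
        have "(\<phi> f \<otimes>\<^bsub>semigroup_algebra R S\<^esub> \<phi> g) s = \<zero>"
        proof (rule ccontr)
          assume "(\<phi> f \<otimes>\<^bsub>semigroup_algebra R S\<^esub> \<phi> g) s \<noteq> \<zero>"
          then obtain t u where "\<phi> f t \<noteq> \<zero>" "\<phi> g u \<noteq> \<zero>" "s = t \<otimes>\<^bsub>S\<^esub> u"
            by (rule semigroup_algebra_mult_nonzeroE)
          then show False using False closed by (auto simp: \<phi>_def split: if_splits)
        qed
        then show ?thesis using False by (simp add: \<phi>_def)
      qed
    qed
  next
    fix f assume f: "f \<in> carrier (semigroup_algebra R T)" "\<phi> f = \<zero>\<^bsub>semigroup_algebra R S\<^esub>"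
    have "f t = \<zero>" for t
    proof (cases "t \<in> carrier T")
      case True
      have "\<phi> f (k t) = \<zero>" unfolding f(2) by (simp add: zero_semigroup_algebra)
      then show ?thesis using hk[OF True] by (simp add: \<phi>_def)
    qed (use f(1) supp in blast)
    then show "f = \<zero>\<^bsub>semigroup_algebra R T\<^esub>" by (auto simp: zero_semigroup_algebra)
  qed
qed

text \<open>This allows the semigroup to be replaced by its image in the group, so that both
  algebras consist of functions on the same type.\<close>

lemma centrally_essential_semigroup_algebra_inj_image:
  fixes S :: "('s, 'm) monoid_scheme" and G :: "('t, 'n) monoid_scheme"
  assumes S: "mult_semigroup S" and hom: "h \<in> hom S G" and inj: "inj_on h (carrier S)"
  shows "centrally_essential (semigroup_algebra R (G\<lparr>carrier := h ` carrier S\<rparr>)) \<longleftrightarrow>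
         centrally_essential (semigroup_algebra R S)"
proof -
  interpret S: mult_semigroup S by (rule S)
  let ?T = "G\<lparr>carrier := h ` carrier S\<rparr>"
  have T: "h \<in> hom S ?T" "bij_betw h (carrier S) (carrier ?T)"
    using hom inj by (auto simp: hom_def bij_betw_def)
  have "inv_into (carrier S) h \<in> hom ?T S"
  proof (rule homI)
    fix x y assume "x \<in> carrier ?T" "y \<in> carrier ?T"
    then obtain a b where ab: "x = h a" "y = h b" "a \<in> carrier S" "b \<in> carrier S" by auto
    then have "h a \<otimes>\<^bsub>?T\<^esub> h b = h (a \<otimes>\<^bsub>S\<^esub> b)" using T(1) by (metis hom_mult)
    then show "inv_into (carrier S) h (x \<otimes>\<^bsub>?T\<^esub> y) =
        inv_into (carrier S) h x \<otimes>\<^bsub>S\<^esub> inv_into (carrier S) h y"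
      using ab inj S.m_closed by simp
  qed (simp add: inv_into_into)
  moreover have "bij_betw (inv_into (carrier S) h) (carrier ?T) (carrier S)"
    using T(2) by (rule bij_betw_inv_into)
  moreover have "x \<otimes>\<^bsub>?T\<^esub> y \<in> carrier ?T" if "x \<in> carrier ?T" "y \<in> carrier ?T" for x y
    using that hom S.m_closed by (auto simp flip: hom_mult)
  ultimately show ?thesis
    using centrally_essential_semigroup_algebra_iso[of S "inv_into (carrier S) h" ?T]
      centrally_essential_semigroup_algebra_iso[OF _ T S.m_closed] by blast
qed

text \<open>If the basis vector of \<open>s\<close> is central, \<open>s\<close> commutes with
  \<open>t\<close> and both conditions are clear. Otherwise let \<open>e\<close> be in the support
  of \<open>x\<close>. Multiplication by a basis vector loses no terms, so s e and e s lie in the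
  support of y = s x = x s. In y t = t y the term (s e) t must have the form t u, and the term t (e
  s) the form v t.\<close>

lemma centrally_essential_imp_ore_pair:
  assumes S: "cancellative_semigroup S"
    and ce: "centrally_essential (semigroup_algebra R S)"
    and st: "s \<in> carrier S" "t \<in> carrier S"
  shows "(\<exists>x\<in>carrier S. \<exists>y\<in>carrier S. s \<otimes>\<^bsub>S\<^esub> x = t \<otimes>\<^bsub>S\<^esub> y) \<and>
         (\<exists>x\<in>carrier S. \<exists>y\<in>carrier S. x \<otimes>\<^bsub>S\<^esub> s = y \<otimes>\<^bsub>S\<^esub> t)"
proof -
  interpret S: cancellative_semigroup S by (rule S)
  let ?A = "semigroup_algebra R S"
  have left: "(single R s \<otimes>\<^bsub>?A\<^esub> f) (s \<otimes>\<^bsub>S\<^esub> g) = f g"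
    if "f \<in> carrier ?A" "s \<in> carrier S" "g \<in> carrier S" for s f g
  proof -
    have "(single R s \<otimes>\<^bsub>?A\<^esub> f) (s \<otimes>\<^bsub>S\<^esub> g) = single R s s \<otimes> f g"
      by (rule semigroup_algebra_mult_unique[OF single_in_carrier[OF that(2)] that(1)])
        (use that S.l_cancel in \<open>auto simp: single_def carrier_semigroup_algebra split: if_splits\<close>)
    then show ?thesis using semigroup_algebra_value[OF that(1)] by (simp add: single_def)
  qed
  have right: "(f \<otimes>\<^bsub>?A\<^esub> single R s) (g \<otimes>\<^bsub>S\<^esub> s) = f g"
    if "f \<in> carrier ?A" "s \<in> carrier S" "g \<in> carrier S" for s f g
  proof -
    have "(f \<otimes>\<^bsub>?A\<^esub> single R s) (g \<otimes>\<^bsub>S\<^esub> s) = f g \<otimes> single R s s"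
      by (rule semigroup_algebra_mult_unique[OF that(1) single_in_carrier[OF that(2)]])
        (use that S.r_cancel in \<open>auto simp: single_def carrier_semigroup_algebra split: if_splits\<close>)
    then show ?thesis using semigroup_algebra_value[OF that(1)] by (simp add: single_def)
  qed
  show ?thesis
  proof (cases "single R s \<in> center ?A")
    case True
    then have "single R s \<otimes>\<^bsub>?A\<^esub> single R t = single R t \<otimes>\<^bsub>?A\<^esub> single R s"
      using single_in_carrier[OF st(2)] by (auto simp: center_def)
    moreover have "(single R s \<otimes>\<^bsub>?A\<^esub> single R t) (s \<otimes>\<^bsub>S\<^esub> t) \<noteq> \<zero>"
      using left[OF single_in_carrier[OF st(2)] st] by (simp add: single_def)
    ultimately have "(single R t \<otimes>\<^bsub>?A\<^esub> single R s) (s \<otimes>\<^bsub>S\<^esub> t) \<noteq> \<zero>" by simp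
    then have "s \<otimes>\<^bsub>S\<^esub> t = t \<otimes>\<^bsub>S\<^esub> s"
      by (rule semigroup_algebra_mult_nonzeroE) simp
    then show ?thesis using st by metis
  next
    case False
    then obtain x y where xy: "x \<in> center ?A" "y \<in> center ?A" "x \<noteq> \<zero>\<^bsub>?A\<^esub>" "single R s \<otimes>\<^bsub>?A\<^esub> x = y"
      using ce single_in_carrier[OF st(1)] unfolding centrally_essential_iff by blast
    have x: "x \<in> carrier ?A" and y: "y \<in> carrier ?A"
      using xy by (auto simp: center_def)
    have sx: "x \<otimes>\<^bsub>?A\<^esub> single R s = y"
      and ty: "y \<otimes>\<^bsub>?A\<^esub> single R t = single R t \<otimes>\<^bsub>?A\<^esub> y"
      using xy single_in_carrier[OF st(1)] single_in_carrier[OF st(2)] by (auto simp: center_def)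
    obtain e where e: "x e \<noteq> \<zero>" using xy(3) by (rule semigroup_algebra_nonzeroE)
    then have eS: "e \<in> carrier S" using x by (auto simp: carrier_semigroup_algebra)
    have "y (s \<otimes>\<^bsub>S\<^esub> e) \<noteq> \<zero>" using left[OF x st(1) eS] e xy(4) by simp
    then have "(single R t \<otimes>\<^bsub>?A\<^esub> y) ((s \<otimes>\<^bsub>S\<^esub> e) \<otimes>\<^bsub>S\<^esub> t) \<noteq> \<zero>"
      using right[OF y st(2), of "s \<otimes>\<^bsub>S\<^esub> e"] st eS S.m_closed ty by simp
    then obtain t' u where 1: "single R t t' \<noteq> \<zero>" "y u \<noteq> \<zero>" "(s \<otimes>\<^bsub>S\<^esub> e) \<otimes>\<^bsub>S\<^esub> t = t' \<otimes>\<^bsub>S\<^esub> u"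
      by (rule semigroup_algebra_mult_nonzeroE)
    then have "t' = t" "u \<in> carrier S"
      using y by (auto simp: carrier_semigroup_algebra)
    then have "s \<otimes>\<^bsub>S\<^esub> (e \<otimes>\<^bsub>S\<^esub> t) = t \<otimes>\<^bsub>S\<^esub> u" "e \<otimes>\<^bsub>S\<^esub> t \<in> carrier S" "u \<in> carrier S"
      using 1 st eS by (auto simp: S.m_assoc S.m_closed)
    moreover
    have "y (e \<otimes>\<^bsub>S\<^esub> s) \<noteq> \<zero>" using right[OF x st(1) eS] e sx by simp
    then have "(y \<otimes>\<^bsub>?A\<^esub> single R t) (t \<otimes>\<^bsub>S\<^esub> (e \<otimes>\<^bsub>S\<^esub> s)) \<noteq> \<zero>"
      using left[OF y st(2), of "e \<otimes>\<^bsub>S\<^esub> s"] st eS S.m_closed ty by simp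
    then obtain t' v where 2: "y v \<noteq> \<zero>" "single R t t' \<noteq> \<zero>" "t \<otimes>\<^bsub>S\<^esub> (e \<otimes>\<^bsub>S\<^esub> s) = v \<otimes>\<^bsub>S\<^esub> t'"
      by (rule semigroup_algebra_mult_nonzeroE)
    then have "t' = t" "v \<in> carrier S"
      using y by (auto simp: carrier_semigroup_algebra)
    then have "(t \<otimes>\<^bsub>S\<^esub> e) \<otimes>\<^bsub>S\<^esub> s = v \<otimes>\<^bsub>S\<^esub> t" "t \<otimes>\<^bsub>S\<^esub> e \<in> carrier S" "v \<in> carrier S"
      using 2 st eS by (auto simp: S.m_assoc S.m_closed)
    ultimately show ?thesis by blast
  qed
qed

end

section \<open>Finite conjugacy classes\<close>

context group
begin

definition conjugates :: "'a \<Rightarrow> 'a set" where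
  "conjugates g = (\<lambda>h. h \<otimes> g \<otimes> inv h) ` carrier G"

lemma conj_mult:
  assumes "g \<in> carrier G" "g' \<in> carrier G" "h \<in> carrier G"
  shows "h \<otimes> (g \<otimes> g') \<otimes> inv h = (h \<otimes> g \<otimes> inv h) \<otimes> (h \<otimes> g' \<otimes> inv h)"
proof -
  have "inv h \<otimes> (h \<otimes> (g' \<otimes> inv h)) = g' \<otimes> inv h"
    using assms by (simp flip: m_assoc)
  then show ?thesis using assms by (simp add: m_assoc)
qed

lemma conj_inv:
  assumes "g \<in> carrier G" "h \<in> carrier G"
  shows "h \<otimes> inv g \<otimes> inv h = inv (h \<otimes> g \<otimes> inv h)"
  using assms by (simp add: inv_mult_group m_assoc)

lemma conj_pow:
  assumes "g \<in> carrier G" "h \<in> carrier G"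
  shows "h \<otimes> g [^] (n::nat) \<otimes> inv h = (h \<otimes> g \<otimes> inv h) [^] n"
proof (induction n)
  case (Suc n)
  then show ?case using assms conj_mult[of "g [^] n" g h] by simp
qed (use assms in simp)

lemma conj_eq_iff_commute:
  assumes "g \<in> carrier G" "h \<in> carrier G"
  shows "h \<otimes> g \<otimes> inv h = g \<longleftrightarrow> g \<otimes> h = h \<otimes> g"
  using assms by (metis inv_closed inv_solve_right m_closed)

text \<open>Conjugation is an endomorphism, so each conjugate of a^-1 b is p^-1 q with conjugates p
  of a and q of b. This extends finiteness from the semigroup to all its fractions.\<close>

lemma finite_conjugates_mult_inv:
  assumes "a \<in> carrier G" "b \<in> carrier G" "finite (conjugates a)" "finite (conjugates b)"
  shows "finite (conjugates (inv a \<otimes> b))"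
proof (rule finite_subset)
  show "conjugates (inv a \<otimes> b) \<subseteq> (\<lambda>(p, q). inv p \<otimes> q) ` (conjugates a \<times> conjugates b)"
  proof
    fix c assume "c \<in> conjugates (inv a \<otimes> b)"
    then obtain h where h: "h \<in> carrier G" "c = h \<otimes> (inv a \<otimes> b) \<otimes> inv h"
      unfolding conjugates_def by blast
    then have "c = inv (h \<otimes> a \<otimes> inv h) \<otimes> (h \<otimes> b \<otimes> inv h)"
      using assms conj_mult[of "inv a" b h] conj_inv[of a h] by simp
    then show "c \<in> (\<lambda>(p, q). inv p \<otimes> q) ` (conjugates a \<times> conjugates b)"
      using h(1) unfolding conjugates_def by auto
  qed
qed (use assms in simp)

text \<open>Pigeonhole: the elements g^n h g^-n all lie in one finite class, so two of them
  coincide, and the difference of the exponents serves as \<open>k\<close>.\<close>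

lemma pow_commutes_if_finite_conjugates:
  assumes g: "g \<in> carrier G" and h: "h \<in> carrier G" "finite (conjugates h)"
  obtains k :: nat where "k > 0" "g [^] k \<otimes> h = h \<otimes> g [^] k"
proof -
  let ?f = "\<lambda>n::nat. g [^] n \<otimes> h \<otimes> inv (g [^] n)"
  have "range ?f \<subseteq> conjugates h" using g unfolding conjugates_def by auto
  then have "\<not> inj ?f" using h(2) by (meson finite_imageD finite_subset infinite_UNIV_nat)
  then obtain i j where ij: "i < j" "?f i = ?f j"
    unfolding inj_def by (metis linorder_neqE_nat)
  define m where "m = j - i"
  have m: "m > 0" "g [^] j = g [^] i \<otimes> g [^] m"
    using ij(1) g by (simp_all add: m_def nat_pow_mult)
  have "g [^] i \<otimes> h \<otimes> inv (g [^] i) = g [^] i \<otimes> (g [^] m \<otimes> h \<otimes> inv (g [^] m)) \<otimes> inv (g [^] i)"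
    using ij(2) g h(1) unfolding m(2) by (simp add: m_assoc inv_mult_group)
  then have "h = g [^] m \<otimes> h \<otimes> inv (g [^] m)"
    using g h(1) by simp
  then have "g [^] m \<otimes> h = h \<otimes> g [^] m"
    using conj_eq_iff_commute[of h "g [^] m"] g h(1) by simp
  then show thesis using m(1) by (rule that[rotated])
qed

text \<open>Exponents for the single elements are multiplied: \<open>g [^] (k * l)\<close> is a
  power of both \<open>g [^] k\<close> and \<open>g [^] l\<close>, hence commutes with whatever
  either of them commutes with.\<close>

lemma pow_commutes_finite_set:
  assumes g: "g \<in> carrier G" and "finite H" "H \<subseteq> carrier G"
    and fc: "\<And>h. h \<in> H \<Longrightarrow> finite (conjugates h)"
  shows "\<exists>k>0::nat. \<forall>h\<in>H. g [^] k \<otimes> h = h \<otimes> g [^] k"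
  using assms(2-4)
proof (induction H)
  case (insert x H)
  then obtain k :: nat where k: "k > 0" "\<forall>h\<in>H. g [^] k \<otimes> h = h \<otimes> g [^] k" by auto
  obtain l :: nat where l: "l > 0" "g [^] l \<otimes> x = x \<otimes> g [^] l"
    using pow_commutes_if_finite_conjugates[OF g, of x] insert.prems by auto
  have "g [^] (k * l) \<otimes> h = h \<otimes> g [^] (k * l)" if "h \<in> H" for h
    using group_commutes_pow[of "g [^] k" h l] k(2) that insert.prems g
    by (auto simp: nat_pow_pow)
  moreover have "g [^] (l * k) \<otimes> x = x \<otimes> g [^] (l * k)"
    using group_commutes_pow[of "g [^] l" x k] l(2) insert.prems g
    by (auto simp: nat_pow_pow)
  ultimately show ?case using k(1) l(1) by (intro exI[of _ "k * l"]) (auto simp: mult.commute)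
qed auto

text \<open>It is enough that the power commutes with one conjugating element for each conjugate.\<close>

lemma central_pow_if_finite_conjugates:
  assumes fc: "\<And>h. h \<in> carrier G \<Longrightarrow> finite (conjugates h)" and g: "g \<in> carrier G"
  obtains k :: nat where "k > 0" "\<And>h. h \<in> carrier G \<Longrightarrow> g [^] k \<otimes> h = h \<otimes> g [^] k"
proof -
  obtain H where H: "H \<subseteq> carrier G" "finite H" "conjugates g = (\<lambda>h. h \<otimes> g \<otimes> inv h) ` H"
    using finite_subset_image[OF fc[OF g], of "\<lambda>h. h \<otimes> g \<otimes> inv h" "carrier G"]
    unfolding conjugates_def by blast
  obtain k :: nat where k: "k > 0" "\<forall>h\<in>H. g [^] k \<otimes> h = h \<otimes> g [^] k"
    using pow_commutes_finite_set[OF g H(2,1)] fc H(1) by auto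
  show thesis
  proof (rule that[OF k(1)])
    fix x assume x: "x \<in> carrier G"
    then have "x \<otimes> g \<otimes> inv x \<in> (\<lambda>h. h \<otimes> g \<otimes> inv h) ` H"
      unfolding H(3)[symmetric] by (simp add: conjugates_def)
    then obtain h where h: "h \<in> H" "x \<otimes> g \<otimes> inv x = h \<otimes> g \<otimes> inv h" by auto
    have hG: "h \<in> carrier G" using h H(1) by auto
    have "x \<otimes> g [^] k \<otimes> inv x = h \<otimes> g [^] k \<otimes> inv h"
      using conj_pow[OF g x, of k] conj_pow[OF g hG, of k] h(2) by simp
    also have "\<dots> = g [^] k"
      using conj_eq_iff_commute[of "g [^] k" h] g hG k(2) h(1) by simp
    finally show "g [^] k \<otimes> x = x \<otimes> g [^] k"
      using conj_eq_iff_commute[of "g [^] k" x] g x by simp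
  qed
qed

end

section \<open>The semigroup algebra inside the group algebra\<close>

text \<open>\<open>T\<close> is the image of the semigroup in its group of fractions. With
  \<open>T\<close> a subset of the group, FT is literally a part of FG with the same multiplication,
  and \<open>T = carrier G\<close> is an admissible instance.\<close>

locale fractions_algebra = group G + F: field F
  for G (structure) and F +
  fixes T
  assumes T_nonempty: "T \<noteq> {}"
    and T_subset: "T \<subseteq> carrier G"
    and T_closed: "a \<in> T \<Longrightarrow> b \<in> T \<Longrightarrow> a \<otimes> b \<in> T"
    and left_fraction: "g \<in> carrier G \<Longrightarrow> \<exists>a\<in>T. \<exists>b\<in>T. g = inv a \<otimes> b"
    and right_fraction: "g \<in> carrier G \<Longrightarrow> \<exists>a\<in>T. \<exists>b\<in>T. g = a \<otimes> inv b"
begin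

abbreviation FG where "FG \<equiv> semigroup_algebra F G"

abbreviation FT where "FT \<equiv> semigroup_algebra F (G\<lparr>carrier := T\<rparr>)"

lemma carrier_FT: "f \<in> carrier FT \<longleftrightarrow> f \<in> carrier FG \<and> supp F f \<subseteq> T"
  using T_subset by (auto simp: carrier_semigroup_algebra)

lemma mult_FT: "f \<otimes>\<^bsub>FT\<^esub> g = f \<otimes>\<^bsub>FG\<^esub> g"
  by (simp add: semigroup_algebra_def)

lemma zero_FT: "\<zero>\<^bsub>FT\<^esub> = \<zero>\<^bsub>FG\<^esub>"
  by (simp add: semigroup_algebra_def)

lemma supp_in_G: "f \<in> carrier FG \<Longrightarrow> f g \<noteq> \<zero>\<^bsub>F\<^esub> \<Longrightarrow> g \<in> carrier G"
  by (auto simp: carrier_semigroup_algebra)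

lemma in_T_imp_G [simp]: "t \<in> T \<Longrightarrow> t \<in> carrier G"
  using T_subset by blast

section \<open>Central elements as class functions, and finiteness of conjugacy classes\<close>

definition class_function :: "('a \<Rightarrow> 'c) \<Rightarrow> bool" where
  "class_function f \<longleftrightarrow> (\<forall>g\<in>carrier G. \<forall>h\<in>carrier G. f (h \<otimes> g \<otimes> inv h) = f g)"

lemma single_mult_apply:
  assumes "f \<in> carrier FG" "t \<in> carrier G" "g \<in> carrier G"
  shows "(single F t \<otimes>\<^bsub>FG\<^esub> f) (t \<otimes> g) = f g"
proof -
  have "(single F t \<otimes>\<^bsub>FG\<^esub> f) (t \<otimes> g) = single F t t \<otimes>\<^bsub>F\<^esub> f g"
    by (rule F.semigroup_algebra_mult_unique[OF F.single_in_carrier[OF assms(2)] assms(1)])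
      (use assms supp_in_G[OF assms(1)] in auto)
  then show ?thesis using F.semigroup_algebra_value[OF assms(1)] by (simp add: single_def)
qed

lemma mult_single_apply:
  assumes "f \<in> carrier FG" "t \<in> carrier G" "g \<in> carrier G"
  shows "(f \<otimes>\<^bsub>FG\<^esub> single F t) (g \<otimes> t) = f g"
proof -
  have "(f \<otimes>\<^bsub>FG\<^esub> single F t) (g \<otimes> t) = f g \<otimes>\<^bsub>F\<^esub> single F t t"
    by (rule F.semigroup_algebra_mult_unique[OF assms(1) F.single_in_carrier[OF assms(2)]])
      (use assms supp_in_G[OF assms(1)] in auto)
  then show ?thesis using F.semigroup_algebra_value[OF assms(1)] by (simp add: single_def)
qed

text \<open>Comparing the coefficients at t g in z t = t z gives z(t g t^-1) = z(g) for t in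
  \<open>T\<close>. Invariance under t^-1 follows by substitution, and left fractions give
  invariance under all of G.\<close>

lemma center_FT_imp_class_function:
  assumes z: "z \<in> center FT"
  shows "class_function z"
proof -
  have zG: "z \<in> carrier FG" using z carrier_FT by (simp add: center_def)
  have conj: "z (t \<otimes> g \<otimes> inv t) = z g" if t: "t \<in> T" and g: "g \<in> carrier G" for t g
  proof -
    have tG: "t \<in> carrier G" using t by simp
    have "single F t \<in> carrier FT" using t by (intro F.single_in_carrier) simp
    then have comm: "z \<otimes>\<^bsub>FG\<^esub> single F t = single F t \<otimes>\<^bsub>FG\<^esub> z"
      using z by (simp add: center_def mult_FT)
    have "z (t \<otimes> g \<otimes> inv t) = (z \<otimes>\<^bsub>FG\<^esub> single F t) ((t \<otimes> g \<otimes> inv t) \<otimes> t)"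
      using mult_single_apply[OF zG tG] g tG by simp
    also have "(t \<otimes> g \<otimes> inv t) \<otimes> t = t \<otimes> g"
      using g tG by (simp add: m_assoc)
    also have "(z \<otimes>\<^bsub>FG\<^esub> single F t) (t \<otimes> g) = z g"
      unfolding comm using single_mult_apply[OF zG tG g] .
    finally show ?thesis .
  qed
  have conj_inv: "z (inv t \<otimes> g \<otimes> t) = z g" if t: "t \<in> T" and g: "g \<in> carrier G" for t g
  proof -
    have "t \<otimes> (inv t \<otimes> g \<otimes> t) \<otimes> inv t = g"
      using t g by (simp add: m_assoc) (simp flip: m_assoc)
    then show ?thesis using conj[OF t, of "inv t \<otimes> g \<otimes> t"] t g by simp
  qed
  show ?thesis
    unfolding class_function_def
  proof (intro ballI)
    fix g h assume g: "g \<in> carrier G" and h: "h \<in> carrier G"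
    obtain a b where ab: "a \<in> T" "b \<in> T" "h = inv a \<otimes> b" using left_fraction[OF h] by blast
    have "h \<otimes> g \<otimes> inv h = inv a \<otimes> (b \<otimes> g \<otimes> inv b) \<otimes> a"
      using ab g by (simp add: inv_mult_group m_assoc)
    then show "z (h \<otimes> g \<otimes> inv h) = z g"
      using conj[OF ab(2) g] conj_inv[OF ab(1), of "b \<otimes> g \<otimes> inv b"] ab g by simp
  qed
qed

text \<open>From t u = u (u^-1 t u): replacing the pair (t, u) by (u, u^-1 t u) matches the terms of
  the two products, as \<open>z\<close> takes the same value at t and at u^-1 t u.\<close>

lemma class_function_commutes:
  assumes z: "z \<in> carrier FG" "class_function z" and f: "f \<in> carrier FG"
  shows "z \<otimes>\<^bsub>FG\<^esub> f = f \<otimes>\<^bsub>FG\<^esub> z"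
proof
  fix s
  have conj: "z (inv u \<otimes> t \<otimes> u) = z t" if "t \<in> carrier G" "u \<in> carrier G" for t u
    using z(2) that unfolding class_function_def by (metis inv_closed inv_inv)
  have cancel1: "u \<otimes> (inv u \<otimes> t) = t" "inv u \<otimes> (u \<otimes> t) = t"
    if "t \<in> carrier G" "u \<in> carrier G" for t u
    using that by (simp_all flip: m_assoc)
  show "(z \<otimes>\<^bsub>FG\<^esub> f) s = (f \<otimes>\<^bsub>FG\<^esub> z) s"
  proof (rule F.semigroup_algebra_mult_eqI[OF z(1) f, where ?h1.0 = "\<lambda>t u. u"
        and ?h2.0 = "\<lambda>t u. inv u \<otimes> t \<otimes> u"
        and ?k1.0 = "\<lambda>t u. t \<otimes> u \<otimes> inv t" and ?k2.0 = "\<lambda>t u. t"], goal_cases)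
    case (1 t u)
    then have tu: "t \<in> carrier G" "u \<in> carrier G" using z f supp_in_G by auto
    have s: "s = t \<otimes> u" using 1 by simp
    show ?case
      using 1(1,2) tu conj[OF tu] F.m_comm[OF F.semigroup_algebra_value[OF z(1)] F.semigroup_algebra_value[OF f]]
      by (simp add: s m_assoc cancel1)
  next
    case (2 t u)
    then have tu: "t \<in> carrier G" "u \<in> carrier G" using z f supp_in_G by auto
    have s: "s = t \<otimes> u" using 2 by simp
    have "z (t \<otimes> u \<otimes> inv t) = z u" using z(2) tu by (simp add: class_function_def)
    then show ?case using 2(1,2) tu by (simp add: s m_assoc cancel1)
  qed
qed

lemma center_FT: "center FT = {z \<in> carrier FT. class_function z}"
  using center_FT_imp_class_function class_function_commutes
  by (auto simp: center_def carrier_FT mult_FT)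

text \<open>With 1 as denominator G is a group of fractions of itself, so what is proved for FT also
  holds for FG.\<close>

lemma fractions_algebra_full: "fractions_algebra G F (carrier G)"
proof unfold_locales
  fix g assume g: "g \<in> carrier G"
  show "\<exists>a\<in>carrier G. \<exists>b\<in>carrier G. g = inv a \<otimes> b"
    using g by (intro bexI[of _ \<one>] bexI[of _ g]) auto
  show "\<exists>a\<in>carrier G. \<exists>b\<in>carrier G. g = a \<otimes> inv b"
    using g by (intro bexI[of _ g] bexI[of _ \<one>]) auto
qed auto

lemma center_FG: "center FG = {z \<in> carrier FG. class_function z}"
  using fractions_algebra.center_FT[OF fractions_algebra_full] by simp

lemma finite_conjugates_T:
  assumes ce: "centrally_essential FT" and t: "t \<in> T"
  shows "finite (conjugates t)"
proof (cases "single F t \<in> center FT")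
  case True
  then have "single F t (h \<otimes> t \<otimes> inv h) = single F t t" if "h \<in> carrier G" for h
    using that t unfolding center_FT class_function_def by auto
  then have "single F t (h \<otimes> t \<otimes> inv h) \<noteq> \<zero>\<^bsub>F\<^esub>" if "h \<in> carrier G" for h
    using that by simp
  then have "conjugates t \<subseteq> {t}"
    unfolding conjugates_def by auto
  then show ?thesis by (rule finite_subset) simp
next
  case False
  have tG: "t \<in> carrier G" using t by simp
  have "single F t \<in> carrier FT" using t by (intro F.single_in_carrier) simp
  then obtain x y where xy: "x \<in> center FT" "y \<in> center FT" "x \<noteq> \<zero>\<^bsub>FT\<^esub>" "single F t \<otimes>\<^bsub>FT\<^esub> x = y"
    using False ce unfolding centrally_essential_iff by blast
  have x: "x \<in> carrier FG" "class_function x" and y: "y \<in> carrier FG" "class_function y"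
    using xy unfolding center_FT carrier_FT by auto
  obtain e where e: "x e \<noteq> \<zero>\<^bsub>F\<^esub>" using xy(3) by (rule semigroup_algebra_nonzeroE)
  have eG: "e \<in> carrier G" using supp_in_G[OF x(1) e] .
  have te: "y (t \<otimes> e) \<noteq> \<zero>\<^bsub>F\<^esub>"
    using single_mult_apply[OF x(1) tG eG] e xy(4) by (simp add: mult_FT)
  \<comment> \<open>Conjugation by h turns t = (t e) e^-1 into a quotient of a conjugate of t e,
    which stays in the support of \<open>y\<close>, by a conjugate of e, which stays in the support
    of \<open>x\<close>.\<close>
  have "conjugates t \<subseteq> (\<lambda>(p, q). p \<otimes> inv q) ` (supp F y \<times> supp F x)"
  proof
    fix c assume "c \<in> conjugates t"
    then obtain h where h: "h \<in> carrier G" "c = h \<otimes> t \<otimes> inv h" unfolding conjugates_def by blast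
    have "h \<otimes> (t \<otimes> e) \<otimes> inv h = c \<otimes> (h \<otimes> e \<otimes> inv h)"
      unfolding h(2) using tG eG h(1) by (rule conj_mult)
    then have "c = (h \<otimes> (t \<otimes> e) \<otimes> inv h) \<otimes> inv (h \<otimes> e \<otimes> inv h)"
      using tG eG h by (simp add: inv_solve_right)
    moreover have "y (h \<otimes> (t \<otimes> e) \<otimes> inv h) \<noteq> \<zero>\<^bsub>F\<^esub>" "x (h \<otimes> e \<otimes> inv h) \<noteq> \<zero>\<^bsub>F\<^esub>"
      using x y e te tG eG h by (simp_all add: class_function_def)
    ultimately show "c \<in> (\<lambda>(p, q). p \<otimes> inv q) ` (supp F y \<times> supp F x)" by force
  qed
  moreover have "finite (supp F y \<times> supp F x)"
    using x y by (simp add: carrier_semigroup_algebra)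
  ultimately show ?thesis by (meson finite_imageI finite_subset)
qed

section \<open>Clearing denominators by central elements of the semigroup\<close>

lemma common_denominator:
  assumes "finite X" "X \<subseteq> carrier G"
  shows "\<exists>s\<in>T. \<forall>x\<in>X. x \<otimes> s \<in> T"
  using assms
proof (induction X)
  case empty
  then show ?case using T_nonempty by blast
next
  case (insert g X)
  then obtain s where s: "s \<in> T" "\<forall>x\<in>X. x \<otimes> s \<in> T" by auto
  \<comment> \<open>\<open>s\<close> clears the denominators of \<open>X\<close>; the remaining
    denominator \<open>d\<close> of \<open>g \<otimes> s\<close> is multiplied on, and the other
    products stay in \<open>T\<close> because \<open>T\<close> is closed.\<close>
  obtain c d where cd: "c \<in> T" "d \<in> T" "g \<otimes> s = c \<otimes> inv d"
    using right_fraction[of "g \<otimes> s"] insert.prems s by auto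
  have "g \<otimes> (s \<otimes> d) = (g \<otimes> s) \<otimes> d" using insert.prems s(1) cd(2) by (simp add: m_assoc)
  also have "\<dots> = c" using cd(1,2) unfolding cd(3) by (simp add: m_assoc)
  finally have "g \<otimes> (s \<otimes> d) \<in> T" using cd by simp
  moreover have "x \<otimes> (s \<otimes> d) \<in> T" if "x \<in> X" for x
    using T_closed[of "x \<otimes> s" d] s cd that insert.prems by (auto simp: m_assoc)
  ultimately show ?case using T_closed s cd by blast
qed

text \<open>A common denominator \<open>s\<close> is replaced by a central power. As
  \<open>T\<close> may lack the identity, k > 0 matters: x s^k = (x s) s^(k-1) is an element of
  \<open>T\<close> multiplied by further factors from \<open>T\<close>, and likewise s^k = s
  s^(k-1).\<close>

lemma central_denominator:
  assumes fc: "\<And>t. t \<in> T \<Longrightarrow> finite (conjugates t)" and X: "finite X" "X \<subseteq> carrier G"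
  obtains z where "z \<in> T" "\<And>h. h \<in> carrier G \<Longrightarrow> z \<otimes> h = h \<otimes> z" "\<And>x. x \<in> X \<Longrightarrow> x \<otimes> z \<in> T"
proof -
  obtain s where s: "s \<in> T" "\<forall>x\<in>X. x \<otimes> s \<in> T" using common_denominator[OF X] by blast
  have "finite (conjugates g)" if g: "g \<in> carrier G" for g
    using left_fraction[OF g] fc finite_conjugates_mult_inv by fastforce
  then obtain k :: nat where k: "k > 0" "\<And>h. h \<in> carrier G \<Longrightarrow> s [^] k \<otimes> h = h \<otimes> s [^] k"
    using central_pow_if_finite_conjugates[of s] s by auto
  obtain m where m: "k = Suc m" using k(1) gr0_implies_Suc by blast
  have pow: "y \<otimes> s [^] n \<in> T" if "y \<in> T" for y and n :: nat
  proof (induction n)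
    case (Suc n)
    then show ?case using T_closed[of "y \<otimes> s [^] n" s] that s by (simp add: m_assoc)
  qed (use that in simp)
  have pow_k: "s [^] k = s \<otimes> s [^] m" unfolding m using s(1) nat_pow_Suc2 by simp
  have "x \<otimes> s [^] k = (x \<otimes> s) \<otimes> s [^] m" if "x \<in> X" for x
    using that X s by (auto simp: pow_k m_assoc)
  then show thesis using that[of "s [^] k"] pow s k(2) pow_k by auto
qed

text \<open>The product of \<open>f\<close> with the basis vector of \<open>z\<close> on the right,
  written as a translation of coefficients. Outside the group the product with \<open>inv z\<close>
  is unconstrained, so zero is prescribed there.\<close>

definition shift :: "'a \<Rightarrow> ('a \<Rightarrow> 'c) \<Rightarrow> 'a \<Rightarrow> 'c" where
  "shift z f g = (if g \<in> carrier G then f (g \<otimes> inv z) else \<zero>\<^bsub>F\<^esub>)"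

lemma shift_apply [simp]:
  "z \<in> carrier G \<Longrightarrow> g \<in> carrier G \<Longrightarrow> shift z f (g \<otimes> z) = f g"
  by (simp add: shift_def m_assoc)

lemma supp_shift:
  assumes f: "f \<in> carrier FG" and z: "z \<in> carrier G"
  shows "supp F (shift z f) = (\<lambda>g. g \<otimes> z) ` supp F f"
proof (intro equalityI subsetI)
  fix g assume "g \<in> supp F (shift z f)"
  then have "g \<in> carrier G" "f (g \<otimes> inv z) \<noteq> \<zero>\<^bsub>F\<^esub>" by (auto simp: shift_def split: if_splits)
  then show "g \<in> (\<lambda>g. g \<otimes> z) ` supp F f"
    using z by (intro image_eqI[of _ _ "g \<otimes> inv z"]) (auto simp: m_assoc)
next
  fix g assume "g \<in> (\<lambda>g. g \<otimes> z) ` supp F f"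
  then show "g \<in> supp F (shift z f)" using z supp_in_G[OF f] by auto
qed

lemma shift_in_carrier:
  assumes f: "f \<in> carrier FG" and z: "z \<in> carrier G"
  shows "shift z f \<in> carrier FG"
  using F.semigroup_algebra_value[OF f] supp_in_G[OF f] f z
  unfolding carrier_semigroup_algebra supp_shift[OF f z] by (auto simp: shift_def)

lemma shift_eq_zeroD:
  assumes f: "f \<in> carrier FG" and z: "z \<in> carrier G" and 0: "shift z f = \<zero>\<^bsub>FG\<^esub>"
  shows "f = \<zero>\<^bsub>FG\<^esub>"
proof -
  have "supp F f = {}" using supp_shift[OF f z] 0 by (auto simp: zero_semigroup_algebra)
  then show ?thesis by (auto simp: zero_semigroup_algebra supp_def)
qed

text \<open>For central z conjugation commutes with translation, h (g z) h^-1 = (h g h^-1) z, and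
  every element of the group has the form g z.\<close>

lemma class_function_shift_iff:
  assumes z: "z \<in> carrier G" "\<And>h. h \<in> carrier G \<Longrightarrow> z \<otimes> h = h \<otimes> z"
  shows "class_function (shift z f) \<longleftrightarrow> class_function f"
proof -
  have conj: "h \<otimes> (g \<otimes> z) \<otimes> inv h = (h \<otimes> g \<otimes> inv h) \<otimes> z" if "g \<in> carrier G" "h \<in> carrier G" for g h
    using that z(1) z(2)[of "inv h"] by (simp add: m_assoc)
  have translate: "g = (g \<otimes> inv z) \<otimes> z" "g \<otimes> inv z \<in> carrier G" if "g \<in> carrier G" for g
    using that z(1) by (simp_all add: m_assoc)
  have "class_function (shift z f) \<longleftrightarrow>
      (\<forall>g\<in>carrier G. \<forall>h\<in>carrier G. shift z f (h \<otimes> (g \<otimes> z) \<otimes> inv h) = shift z f (g \<otimes> z))"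
    unfolding class_function_def using translate z(1) by (metis m_closed)
  also have "\<dots> \<longleftrightarrow> class_function f"
    unfolding class_function_def using z(1) by (simp add: conj)
  finally show ?thesis .
qed

text \<open>This is the associative law f (g z) = (f g) z, obtained directly by reindexing the
  convolution.\<close>

lemma mult_shift:
  assumes f: "f \<in> carrier FG" and g: "g \<in> carrier FG" and z: "z \<in> carrier G"
  shows "f \<otimes>\<^bsub>FG\<^esub> shift z g = shift z (f \<otimes>\<^bsub>FG\<^esub> g)"
proof
  fix s
  show "(f \<otimes>\<^bsub>FG\<^esub> shift z g) s = shift z (f \<otimes>\<^bsub>FG\<^esub> g) s"
  proof (cases "s \<in> carrier G")
    case True
    have "(f \<otimes>\<^bsub>FG\<^esub> g) (s \<otimes> inv z) = (f \<otimes>\<^bsub>FG\<^esub> shift z g) s"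
    proof (rule F.semigroup_algebra_mult_eqI[OF f g, where ?h1.0 = "\<lambda>t u. t"
          and ?h2.0 = "\<lambda>t u. u \<otimes> z" and ?k1.0 = "\<lambda>t u. t" and ?k2.0 = "\<lambda>t u. u \<otimes> inv z"],
        goal_cases)
      case (1 t u)
      then have tu: "t \<in> carrier G" "u \<in> carrier G" using f g supp_in_G by auto
      have "t \<otimes> (u \<otimes> z) = (s \<otimes> inv z) \<otimes> z" using 1(3) tu z by (simp flip: m_assoc)
      then show ?case using 1 tu z True by (simp add: m_assoc)
    next
      case (2 t u)
      then have tu: "t \<in> carrier G" "u \<in> carrier G" "g (u \<otimes> inv z) \<noteq> \<zero>\<^bsub>F\<^esub>"
        using f supp_in_G by (auto simp: shift_def split: if_splits)
      have "t \<otimes> (u \<otimes> inv z) = s \<otimes> inv z" using 2(3) tu z by (simp flip: m_assoc)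
      then show ?case using 2 tu z by (simp add: m_assoc)
    qed
    then show ?thesis using True by (simp add: shift_def)
  next
    case False
    have "(f \<otimes>\<^bsub>FG\<^esub> shift z g) s = \<zero>\<^bsub>F\<^esub>"
    proof (rule ccontr)
      assume "(f \<otimes>\<^bsub>FG\<^esub> shift z g) s \<noteq> \<zero>\<^bsub>F\<^esub>"
      then show False
        by (rule F.semigroup_algebra_mult_nonzeroE)
          (use False supp_in_G[OF f] supp_in_G[OF shift_in_carrier[OF g z]] in auto)
    qed
    then show ?thesis using False by (simp add: shift_def)
  qed
qed

text \<open>This is (f z) g = f (g z): a central z passes from one factor to the other.\<close>

lemma shift_mult:
  assumes f: "f \<in> carrier FG" and g: "g \<in> carrier FG"
    and z: "z \<in> carrier G" "\<And>h. h \<in> carrier G \<Longrightarrow> z \<otimes> h = h \<otimes> z"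
  shows "shift z f \<otimes>\<^bsub>FG\<^esub> g = f \<otimes>\<^bsub>FG\<^esub> shift z g"
proof
  fix s
  have cancel: "(t \<otimes> z) \<otimes> (u \<otimes> inv z) = t \<otimes> u" "(t \<otimes> inv z) \<otimes> (u \<otimes> z) = t \<otimes> u"
    if "t \<in> carrier G" "u \<in> carrier G" for t u
  proof -
    have "(t \<otimes> z) \<otimes> (u \<otimes> inv z) = t \<otimes> (z \<otimes> u) \<otimes> inv z" using that z(1) by (simp add: m_assoc)
    then show "(t \<otimes> z) \<otimes> (u \<otimes> inv z) = t \<otimes> u" using that z by (simp add: m_assoc)
    have "(t \<otimes> inv z) \<otimes> (u \<otimes> z) = t \<otimes> inv z \<otimes> (z \<otimes> u)" using that z by simp
    also have "\<dots> = t \<otimes> (inv z \<otimes> z) \<otimes> u" using that z(1) by (simp only: m_assoc m_closed inv_closed)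
    finally show "(t \<otimes> inv z) \<otimes> (u \<otimes> z) = t \<otimes> u" using that z(1) by simp
  qed
  show "(shift z f \<otimes>\<^bsub>FG\<^esub> g) s = (f \<otimes>\<^bsub>FG\<^esub> shift z g) s"
  proof (rule F.semigroup_algebra_mult_eqI[OF shift_in_carrier[OF f z(1)] g,
        where ?h1.0 = "\<lambda>t u. t \<otimes> inv z" and ?h2.0 = "\<lambda>t u. u \<otimes> z"
        and ?k1.0 = "\<lambda>t u. t \<otimes> z" and ?k2.0 = "\<lambda>t u. u \<otimes> inv z"], goal_cases)
    case (1 t u)
    then have tu: "t \<in> carrier G" "u \<in> carrier G" "f (t \<otimes> inv z) \<noteq> \<zero>\<^bsub>F\<^esub>"
      using g supp_in_G by (auto simp: shift_def split: if_splits)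
    then show ?case using 1 z(1) cancel(2)[of t u] by (simp add: m_assoc shift_def)
  next
    case (2 t u)
    then have tu: "t \<in> carrier G" "u \<in> carrier G" "g (u \<otimes> inv z) \<noteq> \<zero>\<^bsub>F\<^esub>"
      using f supp_in_G by (auto simp: shift_def split: if_splits)
    then show ?case using 2 z(1) cancel(1)[of t u] by (simp add: m_assoc)
  qed
qed

lemma shift_in_center_FG:
  assumes f: "f \<in> center FG - {\<zero>\<^bsub>FG\<^esub>}"
    and z: "z \<in> carrier G" "\<And>h. h \<in> carrier G \<Longrightarrow> z \<otimes> h = h \<otimes> z"
  shows "shift z f \<in> center FG - {\<zero>\<^bsub>FG\<^esub>}"
  using f z shift_in_carrier shift_eq_zeroD class_function_shift_iff[OF z] unfolding center_FG by blast

section \<open>Transfer of central essentiality between FT and FG\<close>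

lemma center_FT_eq: "center FT = center FG \<inter> carrier FT"
  unfolding center_FT center_FG using carrier_FT by blast

text \<open>A central z brings a z into FT, where (a z) x = y can be solved; moving z across gives a
  (x z) = y in FG.\<close>

lemma centrally_essential_FG_if_FT:
  assumes ce: "centrally_essential FT"
  shows "centrally_essential FG"
  unfolding centrally_essential_iff
proof
  fix a assume "a \<in> carrier FG - center FG"
  then have a: "a \<in> carrier FG" "\<not> class_function a" unfolding center_FG by auto
  then have "finite (supp F a)" "supp F a \<subseteq> carrier G" by (auto simp: carrier_semigroup_algebra)
  then obtain z where z: "z \<in> T" "\<And>h. h \<in> carrier G \<Longrightarrow> z \<otimes> h = h \<otimes> z"
      "\<And>x. x \<in> supp F a \<Longrightarrow> x \<otimes> z \<in> T"
    using central_denominator[OF finite_conjugates_T[OF ce]] by blast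
  have zG: "z \<in> carrier G" using z(1) by simp
  have "shift z a \<in> carrier FT"
    using shift_in_carrier[OF a(1) zG] z(3) unfolding carrier_FT supp_shift[OF a(1) zG] by auto
  moreover have "shift z a \<notin> center FT"
    unfolding center_FT using class_function_shift_iff[OF zG z(2)] a(2) by auto
  ultimately obtain x y where xy: "x \<in> center FT - {\<zero>\<^bsub>FT\<^esub>}" "y \<in> center FT - {\<zero>\<^bsub>FT\<^esub>}"
      "shift z a \<otimes>\<^bsub>FT\<^esub> x = y"
    using ce unfolding centrally_essential_iff by blast
  have x: "x \<in> center FG - {\<zero>\<^bsub>FG\<^esub>}" and y: "y \<in> center FG - {\<zero>\<^bsub>FG\<^esub>}"
    using xy unfolding center_FT_eq zero_FT by auto
  have "x \<in> carrier FG" using x by (simp add: center_def)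
  then have "a \<otimes>\<^bsub>FG\<^esub> shift z x = y"
    using shift_mult[OF a(1) _ zG z(2)] xy(3) by (simp add: mult_FT)
  moreover have "shift z x \<in> center FG - {\<zero>\<^bsub>FG\<^esub>}" using x zG z(2) by (rule shift_in_center_FG)
  ultimately show "\<exists>x\<in>center FG - {\<zero>\<^bsub>FG\<^esub>}. \<exists>y\<in>center FG - {\<zero>\<^bsub>FG\<^esub>}. a \<otimes>\<^bsub>FG\<^esub> x = y"
    using y by blast
qed

text \<open>A solution of a x = y in FG may have \<open>x\<close> and \<open>y\<close> outside FT.
  One central z clears the denominators of both supports, and a (x z) = y z is a solution in
  FT.\<close>

lemma centrally_essential_FT_if_FG:
  assumes ce: "centrally_essential FG"
  shows "centrally_essential FT"
  unfolding centrally_essential_iff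
proof
  fix a assume a': "a \<in> carrier FT - center FT"
  then have a: "a \<in> carrier FG" "a \<notin> center FG" by (auto simp: center_FT_eq carrier_FT)
  then obtain x y where xy: "x \<in> center FG - {\<zero>\<^bsub>FG\<^esub>}" "y \<in> center FG - {\<zero>\<^bsub>FG\<^esub>}" "a \<otimes>\<^bsub>FG\<^esub> x = y"
    using ce unfolding centrally_essential_iff by blast
  have xyG: "x \<in> carrier FG" "y \<in> carrier FG" using xy by (auto simp: center_def)
  have "finite (conjugates t)" if "t \<in> T" for t
    using fractions_algebra.finite_conjugates_T[OF fractions_algebra_full, of t] ce that by simp
  moreover have "finite (supp F x \<union> supp F y)" "supp F x \<union> supp F y \<subseteq> carrier G"
    using xyG by (auto simp: carrier_semigroup_algebra)
  ultimately obtain z where z: "z \<in> T" "\<And>h. h \<in> carrier G \<Longrightarrow> z \<otimes> h = h \<otimes> z"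
      "\<And>g. g \<in> supp F x \<union> supp F y \<Longrightarrow> g \<otimes> z \<in> T"
    using central_denominator by blast
  have zG: "z \<in> carrier G" using z(1) by simp
  have "shift z f \<in> center FT - {\<zero>\<^bsub>FT\<^esub>}" if "f = x \<or> f = y" for f
  proof -
    have f: "f \<in> center FG - {\<zero>\<^bsub>FG\<^esub>}" "f \<in> carrier FG" using that xy xyG by auto
    have "shift z f \<in> carrier FT"
      using shift_in_carrier[OF f(2) zG] z(3) that unfolding carrier_FT supp_shift[OF f(2) zG] by auto
    then show ?thesis
      using shift_in_center_FG[OF f(1) zG z(2)] unfolding center_FT_eq zero_FT by blast
  qed
  moreover have "a \<otimes>\<^bsub>FT\<^esub> shift z x = shift z y"
    using mult_shift[OF a(1) xyG(1) zG] xy(3) by (simp add: mult_FT)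
  ultimately show "\<exists>x\<in>center FT - {\<zero>\<^bsub>FT\<^esub>}. \<exists>y\<in>center FT - {\<zero>\<^bsub>FT\<^esub>}. a \<otimes>\<^bsub>FT\<^esub> x = y"
    by blast
qed

end

section \<open>From the image in the group back to the abstract semigroup\<close>

lemma fractions_algebra_image:
  assumes S: "mult_semigroup S" and F: "field F" and G: "group_of_fractions S G \<iota>"
  shows "fractions_algebra G F (\<iota> ` carrier S)"
proof -
  interpret S: mult_semigroup S by (rule S)
  have hom: "\<iota> \<in> hom S G" and "group G" using G by (auto simp: group_of_fractions_def)
  interpret group G by fact
  interpret F: field F by (rule F)
  show ?thesis
  proof unfold_locales
    show "\<iota> ` carrier S \<noteq> {}" using S.nonempty by simp
    show "\<iota> ` carrier S \<subseteq> carrier G" using hom by (auto simp: hom_def)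
    show "a \<otimes>\<^bsub>G\<^esub> b \<in> \<iota> ` carrier S" if ab: "a \<in> \<iota> ` carrier S" "b \<in> \<iota> ` carrier S" for a b
    proof -
      obtain s t where "s \<in> carrier S" "t \<in> carrier S" "a = \<iota> s" "b = \<iota> t" using ab by blast
      then show ?thesis using hom_mult[OF hom, of s t] S.m_closed by (metis imageI)
    qed
    fix g assume "g \<in> carrier G"
    then have "\<exists>a\<in>carrier S. \<exists>b\<in>carrier S. g = inv\<^bsub>G\<^esub> (\<iota> a) \<otimes>\<^bsub>G\<^esub> \<iota> b"
      and "\<exists>c\<in>carrier S. \<exists>d\<in>carrier S. g = \<iota> c \<otimes>\<^bsub>G\<^esub> inv\<^bsub>G\<^esub> (\<iota> d)"
      using G unfolding group_of_fractions_def by simp_all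
    then show "\<exists>a\<in>\<iota> ` carrier S. \<exists>b\<in>\<iota> ` carrier S. g = inv\<^bsub>G\<^esub> a \<otimes>\<^bsub>G\<^esub> b"
      and "\<exists>a\<in>\<iota> ` carrier S. \<exists>b\<in>\<iota> ` carrier S. g = a \<otimes>\<^bsub>G\<^esub> inv\<^bsub>G\<^esub> b"
      by simp_all
  qed
qed

text \<open>Stated for an arbitrary group of fractions, so that one equivalence serves both the
  constructed group and any group that is merely given.\<close>

lemma centrally_essential_group_of_fractions_iff:
  assumes S: "mult_semigroup S" and F: "field F" and G: "group_of_fractions S G \<iota>"
  shows "centrally_essential (semigroup_algebra F G) \<longleftrightarrow> centrally_essential (semigroup_algebra F S)"
proof -
  interpret fractions_algebra G F "\<iota> ` carrier S"
    by (rule fractions_algebra_image[OF assms])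
  have "\<iota> \<in> hom S G" "inj_on \<iota> (carrier S)"
    using G by (auto simp: group_of_fractions_def)
  then have "centrally_essential FT \<longleftrightarrow> centrally_essential (semigroup_algebra F S)"
    by (rule F.centrally_essential_semigroup_algebra_inj_image[OF S])
  then show ?thesis using centrally_essential_FG_if_FT centrally_essential_FT_if_FG by blast
qed

theorem centrally_essential_semigroup_algebra_iff:
  fixes S :: "('s, 'm) monoid_scheme"
  assumes S: "cancellative_semigroup S" and F: "field F"
  shows "centrally_essential (semigroup_algebra F S) \<longleftrightarrow>
    right_ore S \<and> left_ore S \<and>
      (\<exists>(G :: ('s \<times> 's) set monoid) \<iota>.
        group_of_fractions S G \<iota> \<and> centrally_essential (semigroup_algebra F G))"
proof -
  interpret S: cancellative_semigroup S by (rule S)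
  note iff = centrally_essential_group_of_fractions_iff[OF S.mult_semigroup_axioms F]
  show ?thesis
  proof
    assume ce: "centrally_essential (semigroup_algebra F S)"
    have ore: "right_ore S" "left_ore S"
      unfolding S.right_ore_iff S.left_ore_iff
      using field.centrally_essential_imp_ore_pair[OF F S ce] by blast+
    interpret ore_semigroup S using ore by unfold_locales
    \<comment> \<open>The witness consists of graphs on the semigroup, which explains the type of
      \<open>G\<close> in the statement.\<close>
    have "group_of_fractions S fraction_group fraction_embed"
      by (rule group_of_fractions_fraction_group)
    then show "right_ore S \<and> left_ore S \<and>
      (\<exists>(G :: ('s \<times> 's) set monoid) \<iota>.
        group_of_fractions S G \<iota> \<and> centrally_essential (semigroup_algebra F G))"
      using ore ce iff by blast
  qed (use iff in blast)
qed

section \<open>A nilpotent example\<close>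

definition rat_field :: "rat ring" where
  "rat_field = \<lparr>carrier = UNIV, mult = (*), one = 1, zero = 0, add = (+)\<rparr>"

lemma rat_field_simps [simp]:
  "carrier rat_field = UNIV" "x \<otimes>\<^bsub>rat_field\<^esub> y = x * y" "\<one>\<^bsub>rat_field\<^esub> = 1"
  "\<zero>\<^bsub>rat_field\<^esub> = 0" "x \<oplus>\<^bsub>rat_field\<^esub> y = x + y"
  by (simp_all add: rat_field_def)

lemma field_rat_field: "field rat_field"
proof (rule cring.cring_fieldI)
  show "cring rat_field"
  proof (intro cringI abelian_groupI comm_monoidI)
    show "\<exists>y\<in>carrier rat_field. y \<oplus>\<^bsub>rat_field\<^esub> x = \<zero>\<^bsub>rat_field\<^esub>" for x
      by (intro bexI[of _ "- x"]) simp_all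
  qed (simp_all add: algebra_simps)
  show "Units rat_field = carrier rat_field - {\<zero>\<^bsub>rat_field\<^esub>}"
  proof -
    have "\<exists>y. y * x = 1 \<and> x * y = 1" if "x \<noteq> 0" for x :: rat
      using that by (intro exI[of _ "inverse x"]) simp
    then show ?thesis unfolding Units_def by auto
  qed
qed

lemma char_zero_rat_field: "char_zero rat_field"
proof -
  have "[n] \<cdot>\<^bsub>rat_field\<^esub> \<one>\<^bsub>rat_field\<^esub> = of_nat n" for n :: nat
    by (induction n) (simp_all add: add_pow_def nat_pow_def)
  then show ?thesis by (simp add: char_zero_def)
qed

text \<open>The numbers 1, 2, 3 stand for elements \<open>x\<close>, \<open>y\<close>, \<open>c\<close> with \<open>c\<close> central, \<open>4 = xy = xc\<close>,
  \<open>5 = yx = yc\<close>, and every other product is the zero element \<open>0\<close> of the semigroup. All products of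
  three elements vanish, and \<open>x\<close> and \<open>y\<close> are the only non-central elements; multiplication by
  \<open>c\<close> is injective on their linear span.\<close>

definition nilpotent_mult :: "nat \<Rightarrow> nat \<Rightarrow> nat" where
  "nilpotent_mult a b =
     (if a = 1 \<and> (b = 2 \<or> b = 3) \<or> a = 3 \<and> b = 1 then 4
      else if a = 2 \<and> (b = 1 \<or> b = 3) \<or> a = 3 \<and> b = 2 then 5 else 0)"

text \<open>Taking all of \<open>nat\<close> as carrier removes membership conditions; the numbers
  from 6 on annihilate everything. The value of \<open>one\<close> is a placeholder.\<close>

definition nilpotent_semigroup :: "nat monoid" where
  "nilpotent_semigroup = \<lparr>carrier = UNIV, mult = nilpotent_mult, one = 0\<rparr>"

lemma nilpotent_semigroup_simps [simp]:
  "carrier nilpotent_semigroup = UNIV" "a \<otimes>\<^bsub>nilpotent_semigroup\<^esub> b = nilpotent_mult a b"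
  by (simp_all add: nilpotent_semigroup_def)

lemma nilpotent_mult_range: "nilpotent_mult a b \<in> {0, 4, 5}"
  by (simp add: nilpotent_mult_def)

lemma nilpotent_mult_zero: "a \<in> {0, 4, 5} \<Longrightarrow> nilpotent_mult a b = 0 \<and> nilpotent_mult b a = 0"
  by (elim insertE emptyE) (simp_all add: nilpotent_mult_def)

text \<open>The table is symmetric in every entry involving 3, and all numbers other than 1, 2, 3
  annihilate; only the products of 1 with 2 depend on the order.\<close>

lemma nilpotent_mult_commute: "a \<noteq> 1 \<Longrightarrow> a \<noteq> 2 \<Longrightarrow> nilpotent_mult a b = nilpotent_mult b a"
  by (simp add: nilpotent_mult_def conj_commute)

lemma mult_semigroup_nilpotent_semigroup: "mult_semigroup nilpotent_semigroup"
proof unfold_locales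
  fix a b c
  show "a \<otimes>\<^bsub>nilpotent_semigroup\<^esub> b \<otimes>\<^bsub>nilpotent_semigroup\<^esub> c =
      a \<otimes>\<^bsub>nilpotent_semigroup\<^esub> (b \<otimes>\<^bsub>nilpotent_semigroup\<^esub> c)"
    using nilpotent_mult_zero[OF nilpotent_mult_range[of a b], of c]
      nilpotent_mult_zero[OF nilpotent_mult_range[of b c], of a] by simp
qed simp_all

lemma nilpotent_semigroup_algebra:
  defines "A \<equiv> semigroup_algebra rat_field nilpotent_semigroup"
  shows "centrally_essential A" and "\<not> commutative A"
proof -
  interpret field rat_field by (rule field_rat_field)
  have central: "f \<in> center A" if "f \<in> carrier A" "\<And>t. t \<in> {1, 2} \<Longrightarrow> f t = 0" for f
    unfolding A_def
  proof (rule in_center_if_supp_commutes)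
    fix t u assume "f t \<noteq> \<zero>\<^bsub>rat_field\<^esub>"
    then have "t \<noteq> 1" "t \<noteq> 2" using that(2)[of t] by (simp_all only: rat_field_simps insert_iff) blast+
    then show "t \<otimes>\<^bsub>nilpotent_semigroup\<^esub> u = u \<otimes>\<^bsub>nilpotent_semigroup\<^esub> t"
      unfolding nilpotent_semigroup_simps by (rule nilpotent_mult_commute)
  qed (use that in \<open>simp add: A_def\<close>)
  have single: "single rat_field s \<in> carrier A" for s
    unfolding A_def by (rule single_in_carrier) simp
  \<comment> \<open>The basis vector of \<open>c\<close> serves as the central multiplier for every
    non-central element.\<close>
  have single3: "single rat_field 3 \<in> center A - {\<zero>\<^bsub>A\<^esub>}"
  proof -
    have "single rat_field 3 (3 :: nat) \<noteq> \<zero>\<^bsub>A\<^esub> 3"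
      by (simp add: A_def zero_semigroup_algebra single_def)
    then have "single rat_field (3 :: nat) \<noteq> \<zero>\<^bsub>A\<^esub>" by metis
    moreover have "single rat_field (3 :: nat) \<in> center A"
      by (rule central[OF single]) (auto simp: single_def)
    ultimately show ?thesis by simp
  qed
  show "centrally_essential A"
    unfolding centrally_essential_iff
  proof
    fix a assume "a \<in> carrier A - center A"
    then have aA: "a \<in> carrier A" and "a \<notin> center A" by simp_all
    then obtain t where t: "t \<in> {1, 2}" "a t \<noteq> 0" using central by blast
    define y where "y = a \<otimes>\<^bsub>A\<^esub> single rat_field 3"
    \<comment> \<open>Among all products with 3 on the right, the value 4 arises only from 1 and the
      value 5 only from 2, so the coefficient of \<open>a\<close> at 1 or 2 survives
      unchanged.\<close>
    have "y (t \<otimes>\<^bsub>nilpotent_semigroup\<^esub> 3) = a t \<otimes>\<^bsub>rat_field\<^esub> single rat_field 3 (3 :: nat)"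
      unfolding y_def A_def
    proof (rule semigroup_algebra_mult_unique[OF aA[unfolded A_def] single[unfolded A_def]])
      fix t' u' :: nat
      assume "single rat_field 3 u' \<noteq> \<zero>\<^bsub>rat_field\<^esub>"
        and "t' \<otimes>\<^bsub>nilpotent_semigroup\<^esub> u' = t \<otimes>\<^bsub>nilpotent_semigroup\<^esub> 3"
      then have "u' = 3" "nilpotent_mult t' 3 = nilpotent_mult t 3"
        by (simp_all only: single_nonzero_iff nilpotent_semigroup_simps)
      then show "t' = t \<and> u' = 3"
        using t(1) by (auto simp: nilpotent_mult_def split: if_splits)
    qed
    then have "y (nilpotent_mult t 3) \<noteq> 0" using t(2) by (simp add: single_def)
    then have "y \<noteq> \<zero>\<^bsub>A\<^esub>"
      by (auto simp: A_def zero_semigroup_algebra)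
    \<comment> \<open>All products lie in this set, which avoids 1 and 2; hence \<open>y\<close> is
      central.\<close>
    moreover have supp: "s \<in> {0, 4, 5}" if "y s \<noteq> 0" for s
    proof -
      have "y s \<noteq> \<zero>\<^bsub>rat_field\<^esub>" using that by simp
      then show ?thesis
        unfolding y_def A_def
        by (rule semigroup_algebra_mult_nonzeroE) (simp only: nilpotent_semigroup_simps nilpotent_mult_range)
    qed
    have "finite (supp rat_field y)"
      by (rule finite_subset[of _ "{0, 4, 5}"]) (use supp in \<open>simp_all add: subset_iff\<close>)
    then have "y \<in> carrier A"
      unfolding A_def carrier_semigroup_algebra by simp
    then have "y \<in> center A"
      by (rule central) (use supp in force)
    ultimately show "\<exists>x\<in>center A - {\<zero>\<^bsub>A\<^esub>}. \<exists>y\<in>center A - {\<zero>\<^bsub>A\<^esub>}. a \<otimes>\<^bsub>A\<^esub> x = y"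
      using single3 y_def by blast
  qed
  show "\<not> commutative A"
  proof
    assume "commutative A"
    then have "single rat_field 1 \<otimes>\<^bsub>A\<^esub> single rat_field 2 = single rat_field 2 \<otimes>\<^bsub>A\<^esub> single rat_field 1"
      using single unfolding commutative_def by blast
    moreover have "(single rat_field 1 \<otimes>\<^bsub>A\<^esub> single rat_field 2) (1 \<otimes>\<^bsub>nilpotent_semigroup\<^esub> 2) =
        single rat_field 1 (1 :: nat) \<otimes>\<^bsub>rat_field\<^esub> single rat_field 2 (2 :: nat)"
      unfolding A_def
      by (rule semigroup_algebra_mult_unique[OF single[unfolded A_def] single[unfolded A_def]])
        (auto simp only: single_nonzero_iff)
    ultimately have "(single rat_field 2 \<otimes>\<^bsub>A\<^esub> single rat_field 1) (nilpotent_mult 1 2) \<noteq> \<zero>\<^bsub>rat_field\<^esub>"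
      by (simp add: single_def)
    then have "nilpotent_mult 1 2 = nilpotent_mult 2 1"
      unfolding A_def
      by (rule semigroup_algebra_mult_nonzeroE) (simp only: single_nonzero_iff nilpotent_semigroup_simps)
    then show False by (simp add: nilpotent_mult_def)
  qed
qed

theorem theorem1p1:
  shows "(\<forall>(S :: 's monoid) (F :: 'f ring). cancellative_semigroup S \<and> field F \<longrightarrow>
            (centrally_essential (semigroup_algebra F S) \<longleftrightarrow>
               right_ore S \<and> left_ore S \<and>
               (\<exists>(G :: ('s \<times> 's) set monoid) \<iota>.
                  group_of_fractions S G \<iota> \<and> centrally_essential (semigroup_algebra F G))))
       \<and> (\<exists>(F :: rat ring) (S :: nat monoid). field F \<and> char_zero F \<and> mult_semigroup S \<and>
            centrally_essential (semigroup_algebra F S) \<and>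
            \<not> commutative (semigroup_algebra F S))"
proof (intro conjI allI impI)
  fix S :: "'s monoid" and F :: "'f ring"
  assume "cancellative_semigroup S \<and> field F"
  then show "centrally_essential (semigroup_algebra F S) \<longleftrightarrow>
      right_ore S \<and> left_ore S \<and>
      (\<exists>(G :: ('s \<times> 's) set monoid) \<iota>.
        group_of_fractions S G \<iota> \<and> centrally_essential (semigroup_algebra F G))"
    by (intro centrally_essential_semigroup_algebra_iff) simp_all
next
  show "\<exists>(F :: rat ring) (S :: nat monoid). field F \<and> char_zero F \<and> mult_semigroup S \<and>
      centrally_essential (semigroup_algebra F S) \<and> \<not> commutative (semigroup_algebra F S)"
    using field_rat_field char_zero_rat_field mult_semigroup_nilpotent_semigroup
      nilpotent_semigroup_algebra by blast
qed

end
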